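(* Let $\chi$ be a primitive, nonprincipal Dirichlet character modulo $d$, and let $\alpha,\beta\in\mathbb{C}$ with $\mathrm{Re}(\alpha)>0$, $\mathrm{Re}(\beta)>0$ and $\alpha\beta=1$. Then \[ \sqrt{\alpha}F_0(\alpha,\chi)=\sqrt{\beta}F_0(\beta,\chi)=-\frac{1}{2\pi}\left(\frac{\pi}{d}\right)^{b+\frac12}\int_0^{\infty}\left|\frac{\Gamma\left(\frac12+\frac{it}{2}\right)}{\Gamma\left(\frac14+\frac{it}{4}+\frac{b}{2}\right)}\right|^2\Xi\left(-\frac{t}{2},\chi\right)\Xi\left(\frac{t}{2},\chi\right)\cos\left(\frac{t}{2}\log\alpha\right)dt. \]
   Context: For a nonprincipal Dirichlet character $\chi$ modulo $d$, $L(s,\chi)=\sum_{n\ge1}\chi(n)n^{-s}$ for $\mathrm{Re}(s)>1$, extended to an entire function. Define $\psi(x,\chi):=-\sum_{m=1}^{\infty}\frac{\chi(m)}{m+x}$ and $F_0(x,\chi):=\sum_{n=1}^{\infty}\chi(n)\psi(nx,\chi)$ for $x\in\mathbb{C}\setminus(-\infty,0]$. Let $b=0$ if $\chi(-1)=1$ and $b=1$ if $\chi(-1)=-1$. Define $\xi(s,\chi):=\left(\frac{\pi}{d}\right)^{-(s+b)/2}\Gamma\left(\frac{s+b}{2}\right)L(s,\chi)$ and $\Xi(t,\chi):=\xi\left(\frac12+it,\chi\right)$. Square roots and logarithms are principal branches. *)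

theory Defs
  imports "HOL-Complex_Analysis.Complex_Analysis" "HOL-Number_Theory.Number_Theory"
begin

text \<open>
  Characters are extended to all of \<open>\<int>\<close> (being zero off the units modulo \<open>d\<close>), so that
  \<open>chi (-1)\<close> makes sense directly.
\<close>

definition dirichlet_character :: "nat \<Rightarrow> (int \<Rightarrow> complex) \<Rightarrow> bool" where
  "dirichlet_character d chi \<longleftrightarrow>
     d > 0 \<and>
     (\<forall>a b. chi (a * b) = chi a * chi b) \<and>
     (\<forall>a. chi (a + int d) = chi a) \<and>
     (\<forall>a. chi a \<noteq> 0 \<longleftrightarrow> coprime a (int d))"

definition principal_character :: "nat \<Rightarrow> int \<Rightarrow> complex" where
  "principal_character d a = (if coprime a (int d) then 1 else 0)"

definition induced_by :: "nat \<Rightarrow> (int \<Rightarrow> complex) \<Rightarrow> nat \<Rightarrow> (int \<Rightarrow> complex) \<Rightarrow> bool" where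
  "induced_by d chi d' chi' \<longleftrightarrow>
     d' dvd d \<and> dirichlet_character d' chi' \<and>
     (\<forall>a. coprime a (int d) \<longrightarrow> chi a = chi' a)"

definition primitive_character :: "nat \<Rightarrow> (int \<Rightarrow> complex) \<Rightarrow> bool" where
  "primitive_character d chi \<longleftrightarrow>
     dirichlet_character d chi \<and> (\<forall>d' chi'. d' < d \<longrightarrow> \<not> induced_by d chi d' chi')"

text \<open>
  The entire extension is unique by the identity theorem; it exists for every nonprincipal
  character (and only those are considered here).
\<close>

definition L_function :: "(int \<Rightarrow> complex) \<Rightarrow> complex \<Rightarrow> complex" where
  "L_function chi = (THE f. f holomorphic_on UNIV \<and>
     (\<forall>s. Re s > 1 \<longrightarrow> f s = (\<Sum>n. chi (int (Suc n)) * of_nat (Suc n) powr (-s))))"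

definition psi_chi :: "(int \<Rightarrow> complex) \<Rightarrow> complex \<Rightarrow> complex" where
  "psi_chi chi x = - (\<Sum>m. chi (int (Suc m)) / (of_nat (Suc m) + x))"

definition F0 :: "(int \<Rightarrow> complex) \<Rightarrow> complex \<Rightarrow> complex" where
  "F0 chi x = (\<Sum>n. chi (int (Suc n)) * psi_chi chi (of_nat (Suc n) * x))"

text \<open>
  Both series converge only conditionally in general, so they are summed in the natural order;
  the following predicate says that all series entering \<open>F0 chi x\<close> do converge.
\<close>

definition F0_converges :: "(int \<Rightarrow> complex) \<Rightarrow> complex \<Rightarrow> bool" where
  "F0_converges chi x \<longleftrightarrow>
     (\<forall>n. summable (\<lambda>m. chi (int (Suc m)) / (of_nat (Suc m) + of_nat (Suc n) * x))) \<and>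
     summable (\<lambda>n. chi (int (Suc n)) * psi_chi chi (of_nat (Suc n) * x))"

text \<open>For a Dirichlet character, \<open>chi (-1)\<close> is either \<open>1\<close> or \<open>-1\<close>.\<close>

definition char_b :: "(int \<Rightarrow> complex) \<Rightarrow> nat" where
  "char_b chi = (if chi (-1) = 1 then 0 else 1)"

definition xi_chi :: "nat \<Rightarrow> (int \<Rightarrow> complex) \<Rightarrow> complex \<Rightarrow> complex" where
  "xi_chi d chi s =
     complex_of_real (pi / real d) powr (- (s + of_nat (char_b chi)) / 2) *
     Gamma ((s + of_nat (char_b chi)) / 2) * L_function chi s"

definition Xi_chi :: "nat \<Rightarrow> (int \<Rightarrow> complex) \<Rightarrow> complex \<Rightarrow> complex" where
  "Xi_chi d chi t = xi_chi d chi (1 / 2 + \<i> * t)"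

definition Xi_integrand :: "nat \<Rightarrow> (int \<Rightarrow> complex) \<Rightarrow> complex \<Rightarrow> real \<Rightarrow> complex" where
  "Xi_integrand d chi \<alpha> t =
     complex_of_real ((norm (Gamma (1 / 2 + \<i> * of_real t / 2) /
        Gamma (1 / 4 + \<i> * of_real t / 4 + of_nat (char_b chi) / 2)))\<^sup>2) *
     Xi_chi d chi (- of_real t / 2) * Xi_chi d chi (of_real t / 2) *
     cos (of_real t / 2 * Ln \<alpha>)"

end

theory Submission
  imports Defs "HOL-Real_Asymp.Real_Asymp"
begin

text \<open>
  For \<open>m > 0\<close> and \<open>Re y > 0\<close> one has
  \<open>sqrt y / (m + y) = 1/2 \<integral> m^(-1/2 + it) y^(-it) / cosh (\<pi> t) dt\<close> over the real line, which is the
  Fourier transform of the hyperbolic secant. Hence the partial sums of the two series in \<open>F0\<close> are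
  integrals of partial sums of \<open>L(1/2 - it)\<close> and \<open>L(1/2 + it)\<close> against the exponentially decaying
  kernel \<open>x^(-it) / cosh (\<pi> t)\<close>. Summation by parts bounds those partial sums by \<open>C (1 + |t|)\<close>, so
  dominated convergence, first in \<open>m\<close> and then in \<open>n\<close>, gives
  \<open>sqrt x F0(x) = -1/2 \<integral> L(1/2 + it) L(1/2 - it) x^(-it) / cosh (\<pi> t) dt\<close>.
  Folding the integral at \<open>0\<close> makes the integrand even in \<open>log x\<close>, which is the symmetry
  \<open>\<alpha> \<leftrightarrow> \<beta>\<close>; and \<open>|\<Gamma>(1/2 + it)|\<^sup>2 = \<pi> / cosh (\<pi> t)\<close>.
\<close>

section \<open>Dirichlet series with periodic coefficients of mean zero\<close>

text \<open>The property of a nonprincipal character that drives every convergence argument. A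
  suitable discrete primitive has it again, so summation by parts can be iterated. Index
  \<open>n\<close> will carry the coefficient of (n+1)^(-s).\<close>

definition zero_mean_periodic :: "nat \<Rightarrow> (nat \<Rightarrow> complex) \<Rightarrow> bool" where
  "zero_mean_periodic d f \<longleftrightarrow> d > 0 \<and> (\<forall>n. f (n + d) = f n) \<and> (\<Sum>n<d. f n) = 0"

lemma periodic_sum_shift:
  fixes f :: "nat \<Rightarrow> 'a::ab_group_add"
  assumes "\<And>n. f (n + d) = f n"
  shows "(\<Sum>k<d. f (k + n)) = (\<Sum>k<d. f k)"
proof (induction n)
  case (Suc n)
  have "(\<Sum>k<d. f (k + Suc n)) + f n = (\<Sum>k<Suc d. f (k + n))"
    by (subst sum.lessThan_Suc_shift) (simp add: add.commute)
  also have "\<dots> = (\<Sum>k<d. f (k + n)) + f n"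
    using assms[of n] by (simp add: add.commute)
  finally show ?case using Suc by simp
qed simp

lemma zero_mean_periodic_Suc:
  assumes "zero_mean_periodic d f"
  shows "zero_mean_periodic d (\<lambda>n. f (Suc n))"
proof -
  have "f (Suc n + d) = f (Suc n)" for n
    using assms unfolding zero_mean_periodic_def by blast
  then show ?thesis
    using assms periodic_sum_shift[of f d 1] by (auto simp: zero_mean_periodic_def)
qed

text \<open>The partial sums of \<open>f\<close> are periodic because a full period contributes 0;
  subtracting their average over one period makes the primitive itself of mean zero.\<close>

lemma zero_mean_periodic_primitive:
  assumes f: "zero_mean_periodic d f"
  obtains F where "zero_mean_periodic d F" "\<And>n. F (Suc n) - F n = f n"
proof -
  define S where "S = (\<lambda>n. \<Sum>k<n. f k)"
  define F where "F = (\<lambda>n. S n - (\<Sum>k<d. S k) / of_nat d)"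
  have d: "d > 0" and per: "f (n + d) = f n" and mean: "(\<Sum>n<d. f n) = 0" for n
    using f by (auto simp: zero_mean_periodic_def)
  have "S (n + d) = S n" for n
    by (induction n) (auto simp: S_def per mean)
  then have "zero_mean_periodic d F"
    using d by (auto simp: zero_mean_periodic_def F_def sum_subtractf)
  moreover have "F (Suc n) - F n = f n" for n
    by (simp add: F_def S_def)
  ultimately show ?thesis using that by blast
qed

lemma zero_mean_periodic_bounded:
  assumes "zero_mean_periodic d f"
  obtains B where "B > 0" "\<And>n. norm (f n) \<le> B"
proof -
  have d: "d > 0" and per: "f (n + d) = f n" for n
    using assms by (auto simp: zero_mean_periodic_def)
  have per': "f (n + k * d) = f n" for n k
  proof (induction k)
    case (Suc k)
    then show ?case using per[of "n + k * d"] by (simp add: algebra_simps)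
  qed simp
  have "norm (f n) \<le> Max ((\<lambda>n. norm (f n)) ` {..<d})" for n
    using per'[of "n mod d" "n div d"] d by (intro Max_ge) (auto intro!: image_eqI[of _ _ "n mod d"])
  then have "norm (f n) \<le> max 1 (Max ((\<lambda>n. norm (f n)) ` {..<d}))" for n
    by (simp add: le_max_iff_disj)
  then show ?thesis using that[of "max 1 _"] by (metis less_max_iff_disj zero_less_one)
qed

text \<open>The \<open>j\<close>-fold difference of x^(-s), with the sign that summation by parts
  produces. The variable \<open>x\<close> is real rather than an index, so that the mean value
  theorem applies.\<close>

primrec powr_diff :: "nat \<Rightarrow> complex \<Rightarrow> real \<Rightarrow> complex" where
  "powr_diff 0 s x = of_real x powr (-s)"
| "powr_diff (Suc j) s x = powr_diff j s x - powr_diff j s (x + 1)"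

lemma has_vector_derivative_powr_diff:
  assumes "x > 0"
  shows "(powr_diff j s has_vector_derivative (-s * powr_diff j (s + 1) x)) (at x)"
  using assms
proof (induction j arbitrary: x)
  case 0
  have "((\<lambda>z. z powr (-s)) has_field_derivative (-s * of_real x powr (-s - 1))) (at (of_real x))"
    using 0 by (intro has_field_derivative_powr) (auto simp: complex_nonpos_Reals_iff)
  from has_vector_derivative_real_field[OF this] show ?case by simp
next
  case (Suc j)
  have "((powr_diff j s \<circ> (\<lambda>x. x + 1)) has_vector_derivative (1 *\<^sub>R (-s * powr_diff j (s + 1) (x + 1)))) (at x)"
    using Suc by (intro vector_diff_chain_at) (auto intro!: derivative_eq_intros Suc.IH)
  then have "((\<lambda>x. powr_diff j s (x + 1)) has_vector_derivative (-s * powr_diff j (s + 1) (x + 1))) (at x)"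
    by (simp add: o_def)
  from has_vector_derivative_diff[OF Suc.IH[OF Suc.prems] this] show ?case
    by (simp add: algebra_simps fun_eq_iff)
qed

text \<open>Induction by the mean value theorem: a unit difference is at most the derivative at an
  intermediate \<open>y\<close>, and this derivative is \<open>-s\<close> times the next lower
  difference at \<open>s + 1\<close>. The factors s, s+1, ... accumulate to the Pochhammer symbol.
  The condition on \<open>Re s\<close> makes the power nonincreasing, so that \<open>y\<close> can
  be replaced by \<open>x\<close>.\<close>

lemma norm_powr_diff_le:
  assumes "x > 0" "Re s + real j \<ge> 0"
  shows "norm (powr_diff j s x) \<le> norm (pochhammer s j) * x powr (- Re s - real j)"
  using assms
proof (induction j arbitrary: s x)
  case 0
  then show ?case by (simp add: norm_powr_real_powr)
next
  case (Suc j)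
  have "\<exists>y\<in>{x<..<x + 1}. norm (powr_diff j s (x + 1) - powr_diff j s x)
      \<le> norm ((x + 1 - x) *\<^sub>R (-s * powr_diff j (s + 1) y))"
  proof (rule mvt_general)
    show "continuous_on {x..x + 1} (powr_diff j s)"
      using Suc.prems by (intro continuous_at_imp_continuous_on)
        (auto intro!: has_vector_derivative_continuous has_vector_derivative_powr_diff)
    show "(powr_diff j s has_derivative (\<lambda>h. h *\<^sub>R (-s * powr_diff j (s + 1) y))) (at y)"
      if "x < y" "y < x + 1" for y
      using has_vector_derivative_powr_diff[of y j s] that Suc.prems
      by (simp add: has_vector_derivative_def)
  qed auto
  then obtain y where y: "x < y" and le: "norm (powr_diff j s (x + 1) - powr_diff j s x)
      \<le> norm (s * powr_diff j (s + 1) y)"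
    by auto
  have "norm (powr_diff j (s + 1) y) \<le> norm (pochhammer (s + 1) j) * y powr (- Re (s + 1) - real j)"
    using Suc.prems y by (intro Suc.IH) auto
  also have "\<dots> \<le> norm (pochhammer (s + 1) j) * x powr (- Re (s + 1) - real j)"
    using Suc.prems y by (intro mult_left_mono powr_mono2') auto
  also have "- Re (s + 1) - real j = - Re s - real (Suc j)" by simp
  finally have "norm (s * powr_diff j (s + 1) y) \<le>
      norm s * (norm (pochhammer (s + 1) j) * x powr (- Re s - real (Suc j)))"
    by (simp add: norm_mult mult_left_mono)
  with le show ?case
    by (simp add: norm_minus_commute pochhammer_rec norm_mult mult.assoc)
qed

lemma holomorphic_powr_diff [holomorphic_intros]:
  assumes "x > 0"
  shows "(\<lambda>s. powr_diff j s x) holomorphic_on A"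
  using assms
proof (induction j arbitrary: x)
  case 0
  then show ?case by (auto intro!: holomorphic_intros)
qed (auto intro!: holomorphic_intros)

lemma summable_Suc_powr:
  assumes "a < -1"
  shows "summable (\<lambda>n. real (Suc n) powr a)"
  using assms summable_real_powr_iff[of a] summable_Suc_iff[of "\<lambda>n. real n powr a"] by simp

lemma summable_powr_diff_series:
  assumes f: "\<And>n. norm (f n) \<le> B" and s: "Re s + real j > 1"
  shows "summable (\<lambda>n. norm (f n * powr_diff j s (real (Suc n))))"
proof (rule summable_comparison_test')
  show "summable (\<lambda>n. B * (norm (pochhammer s j) * real (Suc n) powr (- Re s - real j)))"
    using s by (intro summable_mult summable_Suc_powr) auto
  have "B \<ge> 0" using f norm_ge_zero order_trans by blast
  then show "norm (norm (f n * powr_diff j s (real (Suc n)))) \<le>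
        B * (norm (pochhammer s j) * real (Suc n) powr (- Re s - real j))" if "n \<ge> 0" for n
    using s norm_powr_diff_le[of "real (Suc n)" s j] f[of n]
    by (simp add: norm_mult mult_mono del: of_nat_Suc)
qed

lemma holomorphic_powr_diff_series:
  assumes f: "\<And>n. norm (f n) \<le> B"
  shows "(\<lambda>s. \<Sum>n. f n * powr_diff j s (real (Suc n))) holomorphic_on {s. Re s > 1 - real j}"
proof (rule holomorphic_uniform_sequence)
  show "open {s. Re s > 1 - real j}" by (rule open_halfspace_Re_gt)
  show "(\<lambda>s. \<Sum>k<n. f k * powr_diff j s (real (Suc k))) holomorphic_on {s. Re s > 1 - real j}" for n
    by (auto intro!: holomorphic_intros simp del: of_nat_Suc)
next
  fix z assume z: "z \<in> {s. Re s > 1 - real j}"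
  then obtain r where r: "r > 0" "cball z r \<subseteq> {s. Re s > 1 - real j}"
    using open_contains_cball[of "{s. Re s > 1 - real j}"] open_halfspace_Re_gt by blast
  \<comment> \<open>The leftmost point of the disc still lies in the open half-plane, so a single
    exponent below -1, namely \<open>- (Re z - r) - real j\<close>, serves the M-test on the whole
    disc.\<close>
  have "z - of_real r \<in> cball z r" using r(1) by (simp add: dist_norm)
  then have "z - of_real r \<in> {s. Re s > 1 - real j}" using r(2) by blast
  then have zr: "Re z - r > 1 - real j" by simp
  have B: "B \<ge> 0" using f norm_ge_zero order_trans by blast
  have "compact ((\<lambda>s. pochhammer s j) ` cball z r)"
    by (intro compact_continuous_image continuous_intros) auto
  then obtain M where M: "\<And>s. s \<in> cball z r \<Longrightarrow> norm (pochhammer s j) \<le> M"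
    by (meson compact_imp_bounded bounded_iff image_eqI)
  have "uniform_limit (cball z r) (\<lambda>n s. \<Sum>k<n. f k * powr_diff j s (real (Suc k)))
     (\<lambda>s. \<Sum>k. f k * powr_diff j s (real (Suc k))) sequentially"
  proof (rule Weierstrass_m_test)
    show "summable (\<lambda>n. B * (M * real (Suc n) powr (- (Re z - r) - real j)))"
      using zr by (intro summable_mult summable_Suc_powr) auto
    fix n s assume s: "s \<in> cball z r"
    have "\<bar>Re (z - s)\<bar> \<le> r" using s abs_Re_le_cmod[of "z - s"] by (simp add: dist_norm)
    then have res: "Re s \<ge> Re z - r" by simp
    have "norm (powr_diff j s (real (Suc n))) \<le> norm (pochhammer s j) * real (Suc n) powr (- Re s - real j)"
      using res zr by (intro norm_powr_diff_le) auto
    also have "\<dots> \<le> M * real (Suc n) powr (- (Re z - r) - real j)"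
      using res M[OF s] order_trans[OF norm_ge_zero M[OF s]] by (intro mult_mono powr_mono) auto
    finally show "norm (f n * powr_diff j s (real (Suc n))) \<le> B * (M * real (Suc n) powr (- (Re z - r) - real j))"
      using f[of n] B by (simp add: norm_mult mult_mono)
  qed
  with r show "\<exists>r>0. cball z r \<subseteq> {s. Re s > 1 - real j} \<and>
      uniform_limit (cball z r) (\<lambda>n s. \<Sum>k<n. f k * powr_diff j s (real (Suc k)))
       (\<lambda>s. \<Sum>k. f k * powr_diff j s (real (Suc k))) sequentially" by blast
qed

section \<open>Summation by parts and analytic continuation\<close>

lemma summation_by_parts:
  fixes F a :: "nat \<Rightarrow> 'a::comm_ring_1"
  shows "(\<Sum>n<N. (F (Suc n) - F n) * a n) =
    (\<Sum>n<N. F (Suc n) * (a n - a (Suc n))) + F N * a N - F 0 * a 0"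
  by (induction N) (auto simp: algebra_simps)

text \<open>Since \<open>F\<close> is bounded, the upper boundary term is O(N^(-Re s - j)) and
  vanishes in the limit, while the differenced series has one more power of decay and converges
  absolutely.\<close>

lemma powr_diff_series_sums:
  assumes F: "\<And>n. norm (F n) \<le> B" and fF: "\<And>n. F (Suc n) - F n = f n"
    and s: "Re s + real j > 0"
  shows "(\<lambda>n. f n * powr_diff j s (real (Suc n))) sums
    ((\<Sum>n. F (Suc n) * powr_diff (Suc j) s (real (Suc n))) - F 0 * powr_diff j s 1)"
proof -
  define a where "a n = powr_diff j s (real (Suc n))" for n
  have B: "B \<ge> 0" using F norm_ge_zero order_trans by blast
  have "(\<lambda>n. F n * a n) \<longlonglongrightarrow> 0"
  proof (rule Lim_null_comparison)
    show "\<forall>\<^sub>F n in sequentially. norm (F n * a n) \<le>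
       B * (norm (pochhammer s j) * real (Suc n) powr (- Re s - real j))"
    proof (rule always_eventually, rule allI)
      show "norm (F n * a n) \<le> B * (norm (pochhammer s j) * real (Suc n) powr (- Re s - real j))" for n
        using s norm_powr_diff_le[of "real (Suc n)" s j] F[of n] B
        by (simp add: norm_mult mult_mono a_def del: of_nat_Suc)
    qed
    have "(\<lambda>n. real (Suc n) powr (- Re s - real j)) \<longlonglongrightarrow> 0"
      using s by (intro tendsto_neg_powr filterlim_compose[OF filterlim_real_sequentially filterlim_Suc]) auto
    then show "(\<lambda>n. B * (norm (pochhammer s j) * real (Suc n) powr (- Re s - real j))) \<longlonglongrightarrow> 0"
      by (intro tendsto_mult_right_zero)
  qed
  moreover have "(\<lambda>N. \<Sum>n<N. F (Suc n) * (a n - a (Suc n))) \<longlonglongrightarrow>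
      (\<Sum>n. F (Suc n) * powr_diff (Suc j) s (real (Suc n)))"
    using summable_norm_cancel[OF summable_powr_diff_series[of "\<lambda>n. F (Suc n)" B s "Suc j"]] F s
    by (simp add: a_def summable_LIMSEQ add.commute)
  ultimately have "(\<lambda>N. (\<Sum>n<N. F (Suc n) * (a n - a (Suc n))) + F N * a N - F 0 * a 0) \<longlonglongrightarrow>
      (\<Sum>n. F (Suc n) * powr_diff (Suc j) s (real (Suc n))) + 0 - F 0 * a 0"
    by (intro tendsto_intros)
  then show ?thesis
    unfolding sums_def summation_by_parts[symmetric] fF by (simp add: a_def)
qed

text \<open>
  Each summation by parts replaces \<open>f\<close> by a periodic primitive of mean zero and \<open>j\<close> by \<open>j + 1\<close>;
  since \<open>powr_diff j s x\<close> is of order \<open>x^(-s - j)\<close>, this gains one unit of convergence.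
\<close>
lemma powr_diff_series_continuation:
  assumes "zero_mean_periodic d f"
  shows "\<exists>E. E holomorphic_on {s. Re s > 1 - real j - real k} \<and>
    (\<forall>s. Re s > 1 - real j \<longrightarrow> (\<lambda>n. f n * powr_diff j s (real (Suc n))) sums E s)"
  using assms
proof (induction k arbitrary: f j)
  case 0
  obtain B where B: "\<And>n. norm (f n) \<le> B" using zero_mean_periodic_bounded[OF 0] by blast
  show ?case
    using holomorphic_powr_diff_series[of f B j, OF B]
      summable_sums[OF summable_norm_cancel[OF summable_powr_diff_series[of f B _ j, OF B]]]
    by (intro exI[of _ "\<lambda>s. \<Sum>n. f n * powr_diff j s (real (Suc n))"]) (auto simp: algebra_simps)
next
  case (Suc k)
  obtain F where F: "zero_mean_periodic d F" "\<And>n. F (Suc n) - F n = f n"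
    using zero_mean_periodic_primitive[OF Suc.prems] by blast
  obtain B where B: "\<And>n. norm (F n) \<le> B" using zero_mean_periodic_bounded[OF F(1)] by blast
  \<comment> \<open>Summation by parts yields \<open>F (Suc n)\<close>, not \<open>F n\<close>, so
    the induction hypothesis is applied to the shifted primitive, which is again periodic of mean
    zero.\<close>
  obtain E where E: "E holomorphic_on {s. Re s > 1 - real (Suc j) - real k}"
    "\<And>s. Re s > 1 - real (Suc j) \<Longrightarrow> (\<lambda>n. F (Suc n) * powr_diff (Suc j) s (real (Suc n))) sums E s"
    using Suc.IH[OF zero_mean_periodic_Suc[OF F(1)], of "Suc j"] by blast
  have "(\<lambda>s. E s - F 0 * powr_diff j s 1) holomorphic_on {s. Re s > 1 - real j - real (Suc k)}"
    using E(1) by (intro holomorphic_intros) (auto simp: algebra_simps)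
  moreover have "(\<lambda>n. f n * powr_diff j s (real (Suc n))) sums (E s - F 0 * powr_diff j s 1)"
    if "Re s > 1 - real j" for s
  proof -
    have "E s = (\<Sum>n. F (Suc n) * powr_diff (Suc j) s (real (Suc n)))"
      using E(2)[of s] that by (simp add: sums_iff)
    then show ?thesis
      using powr_diff_series_sums[of F B f s j] B F(2) that by simp
  qed
  ultimately show ?case by blast
qed

lemma halfplane_connected: "connected {s. Re s > a}"
  by (simp add: convex_connected convex_halfspace_Re_gt)

text \<open>The continuations \<open>E k\<close> to ever larger half-planes all equal the series for
  \<open>Re s > 1\<close>, so they agree on overlaps by the identity theorem and glue to an entire
  function.\<close>

lemma zero_mean_dirichlet_series_entire:
  assumes f: "zero_mean_periodic d f"
  shows "\<exists>G. G holomorphic_on UNIV \<and>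
    (\<forall>s. Re s > 1 \<longrightarrow> (\<lambda>n. f n * of_nat (Suc n) powr (-s)) sums G s)"
proof -
  have "\<exists>E. E holomorphic_on {s. Re s > 1 - real k} \<and>
    (\<forall>s. Re s > 1 \<longrightarrow> (\<lambda>n. f n * of_nat (Suc n) powr (-s)) sums E s)" for k
    using powr_diff_series_continuation[OF f, of 0 k] by (simp del: of_nat_Suc)
  then obtain E where hol: "\<And>k. E k holomorphic_on {s. Re s > 1 - real k}"
    and sums: "\<And>k s. Re s > 1 \<Longrightarrow> (\<lambda>n. f n * of_nat (Suc n) powr (-s)) sums E k s"
    by metis
  have agree: "E k s = E l s" if "k \<le> l" "Re s > 1 - real k" for k l s
  proof (rule analytic_continuation_open[of "{s. Re s > 1}" "{s. Re s > 1 - real k}" "E k" "E l" s])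
    show "{s. Re s > 1} \<noteq> {}" by (auto intro!: exI[of _ 2])
    show "E l holomorphic_on {s. Re s > 1 - real k}"
      by (rule holomorphic_on_subset[OF hol[of l]]) (use that in auto)
    show "E k s = E l s" if "s \<in> {s. Re s > 1}" for s
      using sums[of s k] sums[of s l] that by (auto dest: sums_unique2)
  qed (use that in \<open>auto simp: open_halfspace_Re_gt halfplane_connected hol\<close>)
  \<comment> \<open>Every \<open>k\<close> with \<open>Re s > 1 - real k\<close> gives the same
    value; the ceiling merely selects one such \<open>k\<close> for each \<open>s\<close>.\<close>
  define G where "G s = E (nat \<lceil>2 - Re s\<rceil>) s" for s
  have G: "G s = E k s" if "Re s > 1 - real k" for s k
  proof -
    have "Re s > 1 - real (nat \<lceil>2 - Re s\<rceil>)" by linarith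
    then show ?thesis
      using agree[of k "nat \<lceil>2 - Re s\<rceil>" s] agree[of "nat \<lceil>2 - Re s\<rceil>" k s] that
      unfolding G_def by (metis linear)
  qed
  have "G holomorphic_on UNIV"
  proof (rule holomorphic_on_open[THEN iffD2, rule_format])
    fix z
    obtain k where "1 - Re z < real k" using reals_Archimedean2 by blast
    then have k: "Re z > 1 - real k" by simp
    have "G holomorphic_on {s. Re s > 1 - real k}"
      using hol[of k] by (rule holomorphic_transform) (use G[of k] in auto)
    then show "\<exists>f'. (G has_field_derivative f') (at z)"
      using k by (auto simp: holomorphic_on_open open_halfspace_Re_gt)
  qed auto
  moreover have "(\<lambda>n. f n * of_nat (Suc n) powr (-s)) sums G s" if "Re s > 1" for s
    using sums[OF that, of 0] G[of 0 s] that by simp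
  ultimately show ?thesis by blast
qed

section \<open>Nonprincipal characters and their L-functions\<close>

lemma dirichlet_character_mod:
  assumes "dirichlet_character d chi"
  shows "chi (a mod int d) = chi a"
proof -
  have per: "chi (b + int d) = chi b" for b using assms by (auto simp: dirichlet_character_def)
  have "chi (b + int n * int d) = chi b" for b n
  proof (induction n)
    case (Suc n)
    then show ?case using per[of "b + int n * int d"] by (simp add: algebra_simps)
  qed simp
  note nat = this
  have "chi (b + k * int d) = chi b" for b k
    using nat[of b "nat k"] nat[of "b + k * int d" "nat (-k)"] by (cases "k \<ge> 0") auto
  from this[of "a mod int d" "a div int d"] show ?thesis by simp
qed

text \<open>Orthogonality: multiplication by a unit \<open>a\<close> with \<open>chi a\<close>
  different from 1 permutes the residues, so the sum over a period equals \<open>chi a\<close> times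
  itself and must vanish.\<close>

lemma nonprincipal_zero_mean:
  assumes chi: "dirichlet_character d chi" and np: "chi \<noteq> principal_character d"
  shows "zero_mean_periodic d (\<lambda>n. chi (int (Suc n)))"
proof -
  have d: "d > 0" and per: "chi (b + int d) = chi b" and mult: "chi (a * b) = chi a * chi b"
    and supp: "chi a \<noteq> 0 \<longleftrightarrow> coprime a (int d)" for a b
    using chi by (auto simp: dirichlet_character_def)
  obtain a where "chi a \<noteq> principal_character d a" using np by auto
  \<comment> \<open>Off the units both characters vanish, so a point where they differ is a unit,
    and there the principal character is 1.\<close>
  then have a: "coprime a (int d)" "chi a \<noteq> 1"
    using supp[of a] by (auto simp: principal_character_def split: if_splits)
  have inj: "inj_on (\<lambda>n. a * n mod int d) {0..<int d}"
  proof (rule inj_onI)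
    fix x y assume xy: "x \<in> {0..<int d}" "y \<in> {0..<int d}" "a * x mod int d = a * y mod int d"
    then have "[a * x = a * y] (mod int d)" by (simp add: cong_def)
    then have "[x = y] (mod int d)" using a(1) by (simp add: cong_mult_lcancel)
    then show "x = y" using xy by (simp add: cong_def)
  qed
  have img: "(\<lambda>n. a * n mod int d) ` {0..<int d} = {0..<int d}"
    using d by (intro endo_inj_surj inj) auto
  have "(\<Sum>n\<in>{0..<int d}. chi n) = (\<Sum>n\<in>{0..<int d}. chi (a * n mod int d))"
    using sum.reindex[OF inj, of chi] img by (simp add: o_def)
  also have "\<dots> = chi a * (\<Sum>n\<in>{0..<int d}. chi n)"
    by (simp add: dirichlet_character_mod[OF chi] mult sum_distrib_left)
  finally have "(\<Sum>n\<in>{0..<int d}. chi n) = 0" using a(2) by simp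
  moreover have "(\<Sum>n\<in>{0..<int d}. chi n) = (\<Sum>n<d. chi (int n))"
    by (simp add: image_int_atLeastLessThan[symmetric, of 0, simplified] sum.reindex lessThan_atLeast0)
  moreover have "(\<Sum>n<d. chi (int (n + 1))) = (\<Sum>n<d. chi (int n))"
    using periodic_sum_shift[of "\<lambda>n. chi (int n)" d 1] per by simp
  moreover have "chi (int (Suc (n + d))) = chi (int (Suc n))" for n
    using per[of "int (Suc n)"] by (simp add: add_ac)
  ultimately show ?thesis using d by (simp add: zero_mean_periodic_def)
qed

text \<open>Justifies the definite description: existence is the entire continuation, uniqueness is
  the identity theorem applied from the half-plane \<open>Re s > 1\<close>.\<close>

lemma L_function_extends:
  assumes "zero_mean_periodic d (\<lambda>n. chi (int (Suc n)))"
  shows "L_function chi holomorphic_on UNIV"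
    and "Re s > 1 \<Longrightarrow> (\<lambda>n. chi (int (Suc n)) * of_nat (Suc n) powr (-s)) sums L_function chi s"
proof -
  let ?a = "\<lambda>s n. chi (int (Suc n)) * of_nat (Suc n) powr (-s)"
  obtain G where G: "G holomorphic_on UNIV" "\<And>s. Re s > 1 \<Longrightarrow> ?a s sums G s"
    using zero_mean_dirichlet_series_entire[OF assms] by blast
  have "L_function chi = G"
    unfolding L_function_def
  proof (rule the_equality)
    show "G holomorphic_on UNIV \<and> (\<forall>s. 1 < Re s \<longrightarrow> G s = suminf (?a s))"
      using G by (auto simp: sums_iff)
    fix f assume f: "f holomorphic_on UNIV \<and> (\<forall>s. 1 < Re s \<longrightarrow> f s = suminf (?a s))"
    show "f = G"
    proof
      show "f z = G z" for z
      proof (rule analytic_continuation_open[of "{s. Re s > 1}" UNIV f G z])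
        show "{s. Re s > 1} \<noteq> {}" by (auto intro!: exI[of _ 2])
        show "f s = G s" if "s \<in> {s. Re s > 1}" for s
          using f G(2)[of s] that by (auto simp: sums_iff)
      qed (use f G in \<open>auto simp: open_halfspace_Re_gt\<close>)
    qed
  qed
  then show "L_function chi holomorphic_on UNIV" "Re s > 1 \<Longrightarrow> ?a s sums L_function chi s"
    using G by auto
qed

text \<open>Brings the series itself to the critical line, where the integrals live. One summation
  by parts gives a sum \<open>E\<close> that is holomorphic for \<open>Re s > 0\<close>; the
  identity theorem identifies it with the L-function.\<close>

lemma L_function_sums:
  assumes chi: "zero_mean_periodic d (\<lambda>n. chi (int (Suc n)))" and s: "Re s > 0"
  shows "(\<lambda>n. chi (int (Suc n)) * of_nat (Suc n) powr (-s)) sums L_function chi s"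
proof -
  let ?a = "\<lambda>s n. chi (int (Suc n)) * of_nat (Suc n) powr (-s)"
  obtain F where F: "zero_mean_periodic d F" "\<And>n. F (Suc n) - F n = chi (int (Suc n))"
    using zero_mean_periodic_primitive[OF chi] by blast
  obtain B where B: "\<And>n. norm (F n) \<le> B" using zero_mean_periodic_bounded[OF F(1)] by blast
  define E where "E s = (\<Sum>n. F (Suc n) * powr_diff 1 s (real (Suc n))) - F 0 * powr_diff 0 s 1" for s
  have sums: "?a s sums E s" if "Re s > 0" for s
    using powr_diff_series_sums[of F B _ s 0, OF B F(2)] that by (simp add: E_def)
  have "(\<lambda>s. \<Sum>n. F (Suc n) * powr_diff 1 s (real (Suc n))) holomorphic_on {s. Re s > 0}"
    using holomorphic_powr_diff_series[of "\<lambda>n. F (Suc n)" B 1] B by simp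
  then have hol: "E holomorphic_on {s. Re s > 0}"
    unfolding E_def by (intro holomorphic_intros) auto
  have "L_function chi s = E s"
  proof (rule analytic_continuation_open[of "{s. Re s > 1}" "{s. Re s > 0}" "L_function chi" E s])
    show "{s. Re s > 1} \<noteq> {}" by (auto intro!: exI[of _ 2])
    show "L_function chi s = E s" if "s \<in> {s. Re s > 1}" for s
      using sums[of s] L_function_extends(2)[OF chi, of s] that by (auto dest: sums_unique2)
    show "L_function chi holomorphic_on {s. Re s > 0}"
      using L_function_extends(1)[OF chi] by (rule holomorphic_on_subset) auto
  qed (use s hol in \<open>auto simp: open_halfspace_Re_gt halfplane_connected\<close>)
  with sums[OF s] show ?thesis by simp
qed

text \<open>Supplies the dominating bound for both limits under the integral. For
  \<open>Re s = 1 / 2\<close> consecutive powers differ by at most |s| (n+1)^(-3/2), and |s| is at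
  most 1 + |t|, so the growth in \<open>t\<close> is at most linear. In the constant,
  \<open>K\<close> is zeta(3/2) and the 2 accounts for the two boundary terms.\<close>

lemma critical_line_partial_sums_bound:
  assumes f: "zero_mean_periodic d f"
  obtains C where "C > 0"
    "\<And>N t. norm (\<Sum>n<N. f n * of_nat (Suc n) powr (-(1 / 2 + \<i> * of_real t))) \<le> C * (1 + \<bar>t\<bar>)"
proof -
  obtain F where F: "zero_mean_periodic d F" "\<And>n. F (Suc n) - F n = f n"
    using zero_mean_periodic_primitive[OF f] by blast
  obtain B where B0: "B > 0" and B: "\<And>n. norm (F n) \<le> B" using zero_mean_periodic_bounded[OF F(1)] by blast
  define K where "K = (\<Sum>n. real (Suc n) powr (- 3 / 2))"
  have summable: "summable (\<lambda>n. real (Suc n) powr (- 3 / 2))" by (rule summable_Suc_powr) simp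
  have K: "K \<ge> 0" "(\<Sum>n<N. real (Suc n) powr (- 3 / 2)) \<le> K" for N
    unfolding K_def using summable by (auto intro!: suminf_nonneg sum_le_suminf)
  have "norm (\<Sum>n<N. f n * of_nat (Suc n) powr (-(1 / 2 + \<i> * of_real t))) \<le> B * (2 + K) * (1 + \<bar>t\<bar>)" for N t
  proof -
    define s where "s = 1 / 2 + \<i> * of_real t"
    have ns: "norm s \<le> 1 + \<bar>t\<bar>"
      unfolding s_def by (rule order_trans[OF norm_triangle_ineq]) (simp add: norm_mult)
    define a where "a n = powr_diff 0 s (real (Suc n))" for n
    have a_le: "norm (a n) \<le> 1" for n
    proof -
      have "norm (a n) \<le> real (Suc n) powr (- (1 / 2))"
        using norm_powr_diff_le[of "real (Suc n)" s 0] by (simp add: a_def s_def)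
      also have "\<dots> \<le> 1" using powr_mono[of "-(1/2)" 0 "real (Suc n)"] by simp
      finally show ?thesis .
    qed
    have da: "norm (a n - a (Suc n)) \<le> norm s * real (Suc n) powr (- 3 / 2)" for n
      using norm_powr_diff_le[of "real (Suc n)" s 1] by (simp add: a_def s_def add.commute)
    have "norm (\<Sum>n<N. F (Suc n) * (a n - a (Suc n))) \<le> (\<Sum>n<N. B * (norm s * real (Suc n) powr (- 3 / 2)))"
    proof (rule sum_norm_le)
      show "norm (F (Suc n) * (a n - a (Suc n))) \<le> B * (norm s * real (Suc n) powr (- 3 / 2))" for n
        unfolding norm_mult using B B0 da by (intro mult_mono) auto
    qed
    also have "\<dots> = B * norm s * (\<Sum>n<N. real (Suc n) powr (- 3 / 2))"
      by (simp add: sum_distrib_left mult_ac)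
    also have "\<dots> \<le> B * (1 + \<bar>t\<bar>) * K"
      using B0 ns K by (intro mult_mono) (auto intro!: sum_nonneg)
    finally have 1: "norm (\<Sum>n<N. F (Suc n) * (a n - a (Suc n))) \<le> B * (1 + \<bar>t\<bar>) * K" .
    have 2: "norm (F n * a m) \<le> B" for n m
      using mult_mono[OF B[of n] a_le[of m]] B0 by (simp add: norm_mult)
    have "(\<Sum>n<N. f n * of_nat (Suc n) powr (-s)) = (\<Sum>n<N. (F (Suc n) - F n) * a n)"
      by (simp add: F(2) a_def)
    also have "norm \<dots> \<le> B * (1 + \<bar>t\<bar>) * K + B + B"
      unfolding summation_by_parts
      by (rule order_trans[OF norm_triangle_ineq4] order_trans[OF norm_triangle_ineq] add_mono 1 2)+
    also have "\<dots> \<le> B * (2 + K) * (1 + \<bar>t\<bar>)"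
      using B0 by (simp add: algebra_simps)
    finally show ?thesis by (simp add: s_def)
  qed
  moreover have "B * (2 + K) > 0" using B0 K(1) by (intro mult_pos_pos) auto
  ultimately show ?thesis using that by blast
qed

section \<open>The Fourier transform of the hyperbolic secant\<close>

lemma integrable_exp_neg_abs:
  fixes c :: real
  assumes "c > 0"
  shows "integrable lborel (\<lambda>t. exp (- c * \<bar>t\<bar>))"
proof -
  have "(\<lambda>t. exp (- c * t)) integrable_on {0..}"
    using integrable_on_exp_minus_to_infinity[OF assms, of 0] by simp
  then have "(\<lambda>t. exp (- c * t)) absolutely_integrable_on {0..}"
    by (rule nonnegative_absolutely_integrable_1) simp
  then have "set_integrable lborel {0..} (\<lambda>t. exp (- c * t))"
    unfolding set_integrable_def by (subst (asm) integrable_completion) auto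
  then have "set_integrable lborel {0..} (\<lambda>t. exp (- c * \<bar>t\<bar>))"
    by (rule set_integrable_cong[THEN iffD1, rotated -1]) auto
  then show ?thesis
    unfolding set_integrable_def
    using has_bochner_integral_even_function[OF has_bochner_integral_integrable, of "\<lambda>t. exp (- c * \<bar>t\<bar>)"]
    by (auto simp: has_bochner_integral_iff)
qed

lemma exp_abs_le_cosh:
  fixes x :: real
  shows "exp \<bar>x\<bar> \<le> 2 * cosh x"
proof -
  have "2 * cosh x = exp x + exp (- x)" by (simp add: cosh_def)
  then show ?thesis using exp_ge_zero[of x] exp_ge_zero[of "-x"] by (simp add: abs_if)
qed

lemma norm_exp_div_cosh_le:
  assumes "\<bar>Re z\<bar> \<le> c"
  shows "norm (exp (z * of_real t) / of_real (cosh (pi * t))) \<le> 2 * exp (- (pi - c) * \<bar>t\<bar>)"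
proof -
  have "norm (exp (z * of_real t)) \<le> exp (c * \<bar>t\<bar>)"
  proof -
    have "Re z * t \<le> \<bar>Re z\<bar> * \<bar>t\<bar>" by (metis abs_ge_self abs_mult)
    also have "\<dots> \<le> c * \<bar>t\<bar>" using assms by (intro mult_right_mono) auto
    finally show ?thesis by simp
  qed
  moreover have "inverse (cosh (pi * t)) \<le> 2 * exp (- pi * \<bar>t\<bar>)"
    using exp_abs_le_cosh[of "pi * t"] cosh_real_pos[of "pi * t"]
    by (simp add: field_simps exp_minus abs_mult)
  ultimately have "norm (exp (z * of_real t)) * inverse (cosh (pi * t)) \<le> exp (c * \<bar>t\<bar>) * (2 * exp (- pi * \<bar>t\<bar>))"
    by (intro mult_mono) (auto simp: less_imp_le)
  also have "\<dots> = 2 * exp (- (pi - c) * \<bar>t\<bar>)"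
    by (simp add: exp_add[symmetric] algebra_simps)
  finally show ?thesis
    by (simp add: norm_mult norm_inverse divide_inverse)
qed

lemma exp_div_cosh_measurable [measurable]:
  "(\<lambda>t. exp (z * complex_of_real t) / of_real (cosh (pi * t))) \<in> borel_measurable lborel"
  by (simp add: borel_measurable_continuous_onI continuous_intros)

lemma integrable_exp_div_cosh:
  assumes "\<bar>Re z\<bar> < pi"
  shows "integrable lborel (\<lambda>t. exp (z * of_real t) / complex_of_real (cosh (pi * t)))"
proof (rule Bochner_Integration.integrable_bound)
  show "integrable lborel (\<lambda>t. 2 * exp (- (pi - \<bar>Re z\<bar>) * \<bar>t\<bar>))"
    using assms by (intro integrable_mult_right integrable_exp_neg_abs) auto
  show "AE t in lborel. norm (exp (z * of_real t) / complex_of_real (cosh (pi * t)))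
      \<le> norm (2 * exp (- (pi - \<bar>Re z\<bar>) * \<bar>t\<bar>))"
    using norm_exp_div_cosh_le[of z "\<bar>Re z\<bar>"] by simp
qed measurable

text \<open>
  The logistic substitution \<open>w = 1 / (1 + exp (-2\<pi>t))\<close> turns the Beta integral \<open>B(a, 1 - a)\<close> with
  \<open>a = 1/2 + v/(2\<pi>)\<close> into this integral.
\<close>
lemma integral_exp_div_cosh_real:
  fixes v :: real
  assumes "\<bar>v\<bar> < pi"
  shows "integral\<^sup>L lborel (\<lambda>t. exp (v * t) / cosh (pi * t)) = 1 / cos (v / 2)"
proof -
  define a where "a = 1 / 2 + v / (2 * pi)"
  have a: "0 < a" "a < 1" using assms by (auto simp: a_def field_simps abs_if split: if_splits)
  define g where "g t = 1 / (1 + exp (- (2 * pi * t)))" for t :: real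
  define f where "f w = w powr (a - 1) * (1 - w) powr (- a)" for w :: real
  \<comment> \<open>The logistic equation for the derivative of \<open>g\<close>; in this form
    \<open>g'\<close> raises both exponents of the Beta integrand by one, to \<open>a\<close> and
    \<open>1 - a\<close>.\<close>
  define g' where "g' t = 2 * pi * g t * (1 - g t)" for t :: real
  have pos: "1 + exp (x :: real) > 0" for x by (simp add: add_pos_pos)
  have g: "0 < g t" "g t < 1" for t by (auto simp: g_def pos)
  have deriv: "DERIV g t :> g' t" for t
    unfolding g_def g'_def
    by (rule derivative_eq_intros refl | use pos[of "- (2 * pi * t)"] in \<open>simp add: field_simps power2_eq_square\<close>)+
  have cosh2: "2 * cosh (pi * t) = exp (pi * t) + exp (- (pi * t))" for t
    by (simp add: cosh_def)
  have g_eq: "g t = exp (pi * t) / (2 * cosh (pi * t))" for t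
  proof -
    have "exp (pi * t) + exp (- (pi * t)) = exp (pi * t) * (1 + exp (- (2 * pi * t)))"
      by (simp add: distrib_left exp_add[symmetric])
    then show ?thesis unfolding cosh2 g_def by simp
  qed
  have g1_eq: "1 - g t = exp (- (pi * t)) / (2 * cosh (pi * t))" for t
  proof -
    have "1 - g t = (2 * cosh (pi * t) - exp (pi * t)) / (2 * cosh (pi * t))"
      unfolding g_eq by (simp add: diff_divide_distrib)
    also have "2 * cosh (pi * t) - exp (pi * t) = exp (- (pi * t))" using cosh2[of t] by simp
    finally show ?thesis .
  qed
  \<comment> \<open>The exponents \<open>a\<close> and \<open>1 - a\<close> add up to 1 and leave a
    single hyperbolic cosine; the exponentials combine to exp((2a - 1) pi t) = exp(v t).\<close>
  have fg: "f (g t) * g' t = pi * (exp (v * t) / cosh (pi * t))" for t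
  proof -
    have "f (g t) * g' t = 2 * pi * (g t powr (a - 1) * g t powr 1) * ((1 - g t) powr (- a) * (1 - g t) powr 1)"
      using g[of t] by (simp add: f_def g'_def)
    also have "\<dots> = 2 * pi * g t powr a * (1 - g t) powr (1 - a)"
      by (simp only: powr_add[symmetric]) simp
    also have "g t powr a = exp (a * (pi * t)) / (2 * cosh (pi * t)) powr a"
      unfolding g_eq by (subst powr_divide) (auto simp: powr_def)
    also have "(1 - g t) powr (1 - a) = exp (- (1 - a) * (pi * t)) / (2 * cosh (pi * t)) powr (1 - a)"
      unfolding g1_eq by (subst powr_divide) (auto simp: powr_def algebra_simps)
    also have "2 * pi * (exp (a * (pi * t)) / (2 * cosh (pi * t)) powr a) *
        (exp (- (1 - a) * (pi * t)) / (2 * cosh (pi * t)) powr (1 - a)) =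
        2 * pi * exp (a * (pi * t) + - (1 - a) * (pi * t)) / (2 * cosh (pi * t)) powr (a + (1 - a))"
      unfolding exp_add powr_add by simp
    also have "a * (pi * t) + - (1 - a) * (pi * t) = v * t"
      by (simp add: a_def field_simps)
    finally show ?thesis by simp
  qed
  have int: "integrable lborel (\<lambda>t. exp (v * t) / cosh (pi * t))"
  proof -
    have "integrable lborel (\<lambda>t. complex_of_real (exp (v * t) / cosh (pi * t)))"
      using integrable_exp_div_cosh[of "of_real v"] assms by (simp flip: exp_of_real)
    then show ?thesis by (simp only: complex_of_real_integrable_eq)
  qed
  have sub: "(LBINT x=0..1. f x) = (LBINT x=-\<infinity>..\<infinity>. f (g x) * g' x)"
  proof (rule interval_integral_substitution_nonneg(2))
    show "set_integrable lborel (einterval (-\<infinity>) \<infinity>) (\<lambda>x. f (g x) * g' x)"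
      unfolding fg using integrable_mult_right[OF int, of pi]
      by (simp only: set_integrable_def einterval_eq indicator_UNIV scaleR_one)
    show "((ereal \<circ> g \<circ> real_of_ereal) \<longlongrightarrow> 0) (at_right (-\<infinity>))"
      unfolding zero_ereal_def ereal_tendsto_simps g_def by real_asymp
    show "((ereal \<circ> g \<circ> real_of_ereal) \<longlongrightarrow> 1) (at_left \<infinity>)"
      unfolding one_ereal_def ereal_tendsto_simps g_def by real_asymp
    show "isCont f (g x)" for x
      unfolding f_def using g[of x] by (intro continuous_intros) auto
    show "isCont g' x" for x
      unfolding g'_def using deriv by (intro continuous_intros) (auto intro: DERIV_isCont)
    show "0 \<le> f (g x)" for x by (simp add: f_def)
    show "0 \<le> g' x" for x using g[of x] by (simp add: g'_def)
  qed (use deriv in auto)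
  have "set_integrable lborel {0..1} f"
    using integrable_Beta[of a "1 - a"] a by (simp add: f_def[abs_def])
  then have "(LBINT x=0..1. f x) = integral {0..1} f"
    unfolding zero_ereal_def one_ereal_def by (intro interval_integral_eq_integral) auto
  also have "\<dots> = Beta a (1 - a)"
    using has_integral_Beta_real[of a "1 - a"] a by (simp add: f_def[abs_def] integral_unique)
  also have "\<dots> = pi / sin (pi * a)"
  proof -
    have "complex_of_real (Gamma a * Gamma (1 - a)) = of_real (pi / sin (pi * a))"
      using Gamma_reflection_complex[of "of_real a"]
      by (simp add: sin_of_real[symmetric] Gamma_complex_of_real[symmetric])
    then have "Gamma a * Gamma (1 - a) = pi / sin (pi * a)"
      by (simp only: of_real_eq_iff)
    then show ?thesis by (simp add: Beta_def)
  qed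
  also have "pi * a = v / 2 + pi / 2" by (simp add: a_def field_simps)
  also have "sin (v / 2 + pi / 2) = cos (v / 2)" by (simp add: sin_add)
  finally have "(LBINT x=-\<infinity>..\<infinity>. f (g x) * g' x) = pi / cos (v / 2)" using sub by simp
  then have "pi * integral\<^sup>L lborel (\<lambda>t. exp (v * t) / cosh (pi * t)) = pi / cos (v / 2)"
    unfolding fg by (simp only: interval_lebesgue_integral_def set_lebesgue_integral_def einterval_eq
        indicator_UNIV scaleR_one integral_mult_right_zero) simp
  then have "pi * integral\<^sup>L lborel (\<lambda>t. exp (v * t) / cosh (pi * t)) = pi * (1 / cos (v / 2))" by simp
  then show ?thesis by (simp only: mult_left_cancel[OF pi_neq_zero])
qed

text \<open>The integrals over [-n, n] are holomorphic by differentiation under the integral sign.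
  On a closed disc in the strip one integrable function dominates all integrands, so its tails make
  the convergence uniform and the limit holomorphic.\<close>

lemma holomorphic_exp_div_cosh:
  "(\<lambda>z. \<integral>t. exp (z * of_real t) / complex_of_real (cosh (pi * t)) \<partial>lborel) holomorphic_on {z. \<bar>Re z\<bar> < pi}"
proof -
  define h where "h z t = exp (z * of_real t) / complex_of_real (cosh (pi * t))" for z :: complex and t :: real
  let ?S = "{z. \<bar>Re z\<bar> < pi}"
  have op: "open ?S" by (intro open_Collect_less continuous_intros)
  have [measurable]: "h z \<in> borel_measurable lborel" for z
    unfolding h_def by measurable
  have int: "integrable lborel (h z)" if "z \<in> ?S" for z
    unfolding h_def using integrable_exp_div_cosh[of z] that by simp
  have "(\<lambda>z. integral\<^sup>L lborel (h z)) holomorphic_on ?S"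
  proof (rule holomorphic_uniform_sequence[OF op])
    fix n :: nat
    have "(\<lambda>z. integral (cbox (- real n) (real n)) (h z)) holomorphic_on UNIV"
    proof (rule leibniz_rule_holomorphic)
      show "((\<lambda>z. h z t) has_field_derivative of_real t * h z t) (at z within UNIV)" for z t
        unfolding h_def by (auto intro!: derivative_eq_intros)
      show "h z integrable_on cbox (- real n) (real n)" for z
        unfolding h_def by (intro integrable_continuous continuous_intros) auto
      show "continuous_on (UNIV \<times> cbox (- real n) (real n)) (\<lambda>(z, t). of_real t * h z t)"
        unfolding h_def split_def by (intro continuous_intros) auto
    qed auto
    moreover have "(LBINT t:{- real n..real n}. h z t) = integral (cbox (- real n) (real n)) (h z)" for z
      unfolding h_def cbox_interval
      by (intro set_borel_integral_eq_integral(2) borel_integrable_atLeastAtMost' continuous_intros) auto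
    ultimately show "(\<lambda>z. LBINT t:{- real n..real n}. h z t) holomorphic_on ?S"
      using holomorphic_on_subset by simp blast
  next
    fix z assume z: "z \<in> ?S"
    then obtain r where r: "r > 0" "cball z r \<subseteq> ?S"
      using op open_contains_cball by blast
    \<comment> \<open>By compactness the largest |Re w| on the disc is attained at a point of the
      open strip, hence is below pi; it fixes the decay rate of the common dominating
      function.\<close>
    have "\<exists>y\<in>cball z r. \<forall>w\<in>cball z r. \<bar>Re w\<bar> \<le> \<bar>Re y\<bar>"
      using r(1) by (intro continuous_attains_sup continuous_intros) auto
    then obtain y where y: "y \<in> cball z r" "\<And>w. w \<in> cball z r \<Longrightarrow> \<bar>Re w\<bar> \<le> \<bar>Re y\<bar>"
      by blast
    define c where "c = \<bar>Re y\<bar>"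
    have c: "c < pi" using y(1) r(2) by (auto simp: c_def)
    define w where "w t = 2 * exp (- (pi - c) * \<bar>t\<bar>)" for t :: real
    have [measurable]: "w \<in> borel_measurable lborel" unfolding w_def by measurable
    have w_int: "integrable lborel w"
      unfolding w_def using c by (intro integrable_mult_right integrable_exp_neg_abs) auto
    have w_nonneg: "w t \<ge> 0" for t by (simp add: w_def)
    have h_le: "norm (h s t) \<le> w t" if "s \<in> cball z r" for s t
      unfolding h_def w_def using y(2)[OF that] by (intro norm_exp_div_cosh_le) (simp add: c_def)
    have lim: "(\<lambda>n. \<integral>t. indicator (- {- real n..real n}) t * w t \<partial>lborel) \<longlonglongrightarrow> integral\<^sup>L lborel (\<lambda>t::real. 0)"
    proof (rule integral_dominated_convergence[where w = w])
      show "AE t in lborel. (\<lambda>n. indicator (- {- real n..real n}) t * w t) \<longlonglongrightarrow> 0"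
      proof (rule AE_I2)
        fix t :: real
        obtain N where N: "\<bar>t\<bar> \<le> real N" using real_arch_simple by blast
        have "\<forall>\<^sub>F n in sequentially. indicator (- {- real n..real n}) t * w t = 0"
          using eventually_ge_at_top[of N] by eventually_elim (use N in \<open>auto simp: indicator_def\<close>)
        then show "(\<lambda>n. indicator (- {- real n..real n}) t * w t) \<longlonglongrightarrow> 0"
          by (simp add: tendsto_eventually)
      qed
      show "AE t in lborel. norm (indicator (- {- real n..real n}) t * w t) \<le> w t" for n
        using w_nonneg by (auto simp: indicator_def)
    qed (use w_int in measurable)
    have "uniform_limit (cball z r) (\<lambda>n s. LBINT t:{- real n..real n}. h s t) (\<lambda>s. integral\<^sup>L lborel (h s)) sequentially"
    proof (rule uniform_limitI)
      fix e :: real assume "e > 0"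
      have "\<forall>\<^sub>F n in sequentially. (\<integral>t. indicator (- {- real n..real n}) t * w t \<partial>lborel) < e"
        using order_tendstoD(2)[OF lim] \<open>e > 0\<close> by simp
      then show "\<forall>\<^sub>F n in sequentially. \<forall>s\<in>cball z r. dist (LBINT t:{- real n..real n}. h s t) (integral\<^sup>L lborel (h s)) < e"
      proof eventually_elim
        case (elim n)
        show ?case
        proof
          fix s assume s: "s \<in> cball z r"
          have hs: "integrable lborel (h s)" using int s r(2) by blast
          have si: "integrable lborel (\<lambda>t. indicator {- real n..real n} t *\<^sub>R h s t)"
            using hs by (rule integrable_mult_indicator[rotated]) simp
          have "integral\<^sup>L lborel (h s) - (LBINT t:{- real n..real n}. h s t) =
              (\<integral>t. h s t - indicator {- real n..real n} t *\<^sub>R h s t \<partial>lborel)"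
            unfolding set_lebesgue_integral_def using hs si by simp
          also have "norm \<dots> \<le> (\<integral>t. indicator (- {- real n..real n}) t * w t \<partial>lborel)"
          proof (rule Bochner_Integration.integral_norm_bound_integral)
            show "integrable lborel (\<lambda>t. h s t - indicator {- real n..real n} t *\<^sub>R h s t)"
              using hs si by simp
            show "integrable lborel (\<lambda>t. indicator (- {- real n..real n}) t * w t)"
              using integrable_mult_indicator[OF _ w_int, of "- {- real n..real n}"] by simp
            show "norm (h s t - indicator {- real n..real n} t *\<^sub>R h s t) \<le> indicator (- {- real n..real n}) t * w t" for t
              using h_le[OF s, of t] by (auto simp: indicator_def)
          qed
          finally show "dist (LBINT t:{- real n..real n}. h s t) (integral\<^sup>L lborel (h s)) < e"
            using elim by (simp add: dist_norm norm_minus_commute)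
        qed
      qed
    qed
    with r show "\<exists>r>0. cball z r \<subseteq> ?S \<and> uniform_limit (cball z r)
        (\<lambda>n s. LBINT t:{- real n..real n}. h s t) (\<lambda>s. integral\<^sup>L lborel (h s)) sequentially"
      by blast
  qed
  then show ?thesis by (simp add: h_def[abs_def])
qed

lemma cos_nonzero_strip:
  fixes z :: complex
  assumes "\<bar>Re z\<bar> < pi / 2"
  shows "cos z \<noteq> 0"
proof -
  have "cos (Re z) > 0" using assms by (intro cos_gt_zero_pi) auto
  then have "Re (cos z) > 0" by (simp add: Re_cos add_pos_pos)
  then show ?thesis by auto
qed

text \<open>Both sides are holomorphic in the strip and agree on the real segment [-1, 1], which
  accumulates at 0. Complex \<open>z\<close> matter because the logarithm of a complex argument
  enters below, its imaginary part becoming \<open>Re z\<close>.\<close>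

lemma integral_exp_div_cosh:
  assumes "\<bar>Re z\<bar> < pi"
  shows "(\<integral>t. exp (z * of_real t) / complex_of_real (cosh (pi * t)) \<partial>lborel) = 1 / cos (z / 2)"
proof -
  define J where "J z = (\<integral>t. exp (z * of_real t) / complex_of_real (cosh (pi * t)) \<partial>lborel)" for z
  let ?S = "{z. \<bar>Re z\<bar> < pi}"
  have "J z - 1 / cos (z / 2) = 0"
  proof (rule analytic_continuation[of "\<lambda>z. J z - 1 / cos (z / 2)" ?S "of_real ` {-1..1}" 0 z])
    have "\<forall>z\<in>?S. cos (z / 2) \<noteq> 0" using cos_nonzero_strip by auto
    then show "(\<lambda>z. J z - 1 / cos (z / 2)) holomorphic_on ?S"
      unfolding J_def using holomorphic_exp_div_cosh by (intro holomorphic_intros) auto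
    show "open ?S" by (intro open_Collect_less continuous_intros)
    have "?S = {z. Re z > - pi} \<inter> {z. Re z < pi}" by auto
    then show "connected ?S"
      by (simp add: convex_Int convex_connected convex_halfspace_Re_gt convex_halfspace_Re_lt)
    show "of_real ` {-1..1} \<subseteq> ?S" using pi_gt3 by auto
    show "0 islimpt complex_of_real ` {-1..1}"
    proof (rule islimpt_approachable[THEN iffD2, rule_format])
      fix e :: real assume "e > 0"
      then show "\<exists>x'\<in>complex_of_real ` {- 1..1}. x' \<noteq> 0 \<and> dist x' 0 < e"
        by (intro bexI[of _ "of_real (min 1 (e / 2))"]) (auto simp: min_def)
    qed
    show "J w - 1 / cos (w / 2) = 0" if "w \<in> of_real ` {-1..1}" for w
    proof -
      obtain v where v: "w = of_real v" "v \<in> {-1..1}" using \<open>w \<in> _\<close> by blast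
      then have v_pi: "\<bar>v\<bar> < pi" using pi_gt3 by auto
      have "J w = (\<integral>t. complex_of_real (exp (v * t) / cosh (pi * t)) \<partial>lborel)"
        by (simp add: J_def v flip: exp_of_real)
      also have "\<dots> = of_real (1 / cos (v / 2))"
        by (simp only: integral_complex_of_real integral_exp_div_cosh_real[OF v_pi])
      finally show ?thesis by (simp add: v cos_of_real[symmetric])
    qed
  qed (use assms in auto)
  then show ?thesis by (simp add: J_def)
qed

section \<open>The integral representation\<close>

text \<open>With p, q the square roots of \<open>y\<close>, \<open>r\<close> and
  \<open>u = Ln y - ln r\<close>, the secant integral at \<open>- \<i> * u\<close> is 1/cosh(u/2) =
  2pq / (p^2 + q^2), and dividing by 2q leaves p / (r + y). The exponent is written with
  \<open>- t\<close> so that it is a term of the series for L(1/2 - it).\<close>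

lemma inverse_add_eq_integral:
  fixes r :: real
  assumes r: "r > 0" and y: "Re y > 0"
  shows "exp (Ln y / 2) * (1 / (of_real r + y)) =
    1 / 2 * (\<integral>t. of_real r powr (- (1 / 2 + \<i> * of_real (- t))) *
      (exp (- \<i> * Ln y * of_real t) / of_real (cosh (pi * t))) \<partial>lborel)"
proof -
  define u where "u = Ln y - of_real (ln r)"
  define p where "p = exp (Ln y / 2)"
  define q where "q = exp (complex_of_real (ln r) / 2)"
  have y0: "y \<noteq> 0" using y by auto
  have "p\<^sup>2 = y" using y0 by (simp add: p_def exp_double[symmetric])
  have "q\<^sup>2 = of_real r" using r by (simp add: q_def exp_double[symmetric] exp_of_real)
  have pq: "p \<noteq> 0" "q \<noteq> 0" by (simp_all add: p_def q_def)
  have lnr: "Ln (of_real r) = of_real (ln r)" using r by (simp add: Ln_of_real)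
  have "of_real r powr (- (1 / 2 + \<i> * of_real (- t))) * (exp (- \<i> * Ln y * of_real t) / of_real (cosh (pi * t)))
      = 1 / q * (exp ((- \<i> * u) * of_real t) / of_real (cosh (pi * t)))" for t
  proof -
    have "of_real r powr (- (1 / 2 + \<i> * of_real (- t))) * exp (- \<i> * Ln y * of_real t) =
        exp ((- (1 / 2 + \<i> * of_real (- t))) * of_real (ln r) + - \<i> * Ln y * of_real t)"
      unfolding exp_add using r by (simp add: powr_def lnr)
    also have "(- (1 / 2 + \<i> * of_real (- t))) * of_real (ln r) + - \<i> * Ln y * of_real t =
        - (of_real (ln r) / 2) + (- \<i> * u) * of_real t"
      by (simp add: u_def algebra_simps)
    also have "exp \<dots> = 1 / q * exp ((- \<i> * u) * of_real t)"
      unfolding exp_add q_def by (simp add: exp_minus field_simps)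
    finally show ?thesis by simp
  qed
  then have "(\<integral>t. of_real r powr (- (1 / 2 + \<i> * of_real (- t))) *
      (exp (- \<i> * Ln y * of_real t) / of_real (cosh (pi * t))) \<partial>lborel) =
      1 / q * (\<integral>t. exp ((- \<i> * u) * of_real t) / of_real (cosh (pi * t)) \<partial>lborel)"
    by (simp only: integral_mult_right_zero)
  also have "(\<integral>t. exp ((- \<i> * u) * of_real t) / of_real (cosh (pi * t)) \<partial>lborel) = 1 / cos ((- \<i> * u) / 2)"
  proof (rule integral_exp_div_cosh)
    have "\<bar>Im (Ln y)\<bar> < pi / 2" using y by (rule Re_Ln_pos_lt_imp)
    then show "\<bar>Re (- \<i> * u)\<bar> < pi" by (simp add: u_def)
  qed
  also have "cos ((- \<i> * u) / 2) = (p / q + q / p) / 2"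
  proof -
    have 1: "\<i> * ((- \<i> * u) / 2) = Ln y / 2 - of_real (ln r) / 2"
      by (simp add: u_def diff_divide_distrib)
    have 2: "- (\<i> * ((- \<i> * u) / 2)) = of_real (ln r) / 2 - Ln y / 2"
      by (simp add: u_def diff_divide_distrib)
    have "cos ((- \<i> * u) / 2) = (exp (\<i> * ((- \<i> * u) / 2)) + exp (- (\<i> * ((- \<i> * u) / 2)))) / 2"
      by (rule cos_exp_eq)
    then show ?thesis unfolding 1 2 by (simp add: exp_diff p_def q_def)
  qed
  also have "1 / 2 * (1 / q * (1 / ((p / q + q / p) / 2))) = p / (p\<^sup>2 + q\<^sup>2)"
  proof -
    have "p / q + q / p = (p\<^sup>2 + q\<^sup>2) / (p * q)" using pq by (simp add: field_simps power2_eq_square)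
    then show ?thesis using pq by simp
  qed
  also have "p\<^sup>2 + q\<^sup>2 = of_real r + y" by (simp add: \<open>p\<^sup>2 = y\<close> \<open>q\<^sup>2 = of_real r\<close>)
  finally show ?thesis by (simp add: p_def)
qed

text \<open>As |Im (Ln x)| < pi/2, the kernel is at most 2 exp(-(pi/2)|t|). The factor (1 + |t|)^2
  is at most 4 exp(|t|), and pi/2 > 1 leaves exponential decay. Quadratic growth is allowed because
  the second limit involves a partial sum times an L-value, each of linear growth.\<close>

lemma kernel_dominated_convergence:
  fixes A :: "nat \<Rightarrow> real \<Rightarrow> complex"
  assumes x: "Re x > 0"
    and meas [measurable]: "\<And>n. A n \<in> borel_measurable lborel" "A' \<in> borel_measurable lborel"
    and lim: "\<And>t. (\<lambda>n. A n t) \<longlonglongrightarrow> A' t"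
    and bound: "\<And>n t. norm (A n t) \<le> C * (1 + \<bar>t\<bar>)\<^sup>2"
  defines "k \<equiv> \<lambda>t. exp (- \<i> * Ln x * complex_of_real t) / of_real (cosh (pi * t))"
  shows "integrable lborel (\<lambda>t. A n t * k t)" "integrable lborel (\<lambda>t. A' t * k t)"
    and "(\<lambda>n. \<integral>t. A n t * k t \<partial>lborel) \<longlonglongrightarrow> (\<integral>t. A' t * k t \<partial>lborel)"
proof -
  define w where "w t = 8 * C * exp (- (pi / 2 - 1) * \<bar>t\<bar>)" for t :: real
  have w: "integrable lborel w"
    unfolding w_def using pi_gt3 by (intro integrable_mult_right integrable_exp_neg_abs) simp
  have C: "C \<ge> 0" using order_trans[OF norm_ge_zero bound[of 0 0]] by simp
  have [measurable]: "k \<in> borel_measurable lborel" unfolding k_def by measurable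
  have k_le: "norm (k t) \<le> 2 * exp (- (pi - pi / 2) * \<bar>t\<bar>)" for t
    unfolding k_def using Re_Ln_pos_lt_imp[OF x] by (intro norm_exp_div_cosh_le) auto
  have le: "norm (A n t * k t) \<le> w t" for n t
  proof -
    have "1 + \<bar>t\<bar> \<le> 2 * exp (\<bar>t\<bar> / 2)"
      using exp_ge_add_one_self[of "\<bar>t\<bar> / 2"] by linarith
    then have "(1 + \<bar>t\<bar>)\<^sup>2 \<le> (2 * exp (\<bar>t\<bar> / 2))\<^sup>2" by (intro power_mono) auto
    also have "\<dots> = 4 * exp \<bar>t\<bar>" by (simp add: power_mult_distrib exp_double[symmetric])
    finally have "norm (A n t) \<le> C * (4 * exp \<bar>t\<bar>)"
      using order_trans[OF bound mult_left_mono[OF _ C]] by blast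
    then have "norm (A n t) * norm (k t) \<le> C * (4 * exp \<bar>t\<bar>) * (2 * exp (- (pi - pi / 2) * \<bar>t\<bar>))"
      using k_le C by (intro mult_mono) auto
    also have "\<dots> = 8 * C * exp (\<bar>t\<bar> + - (pi - pi / 2) * \<bar>t\<bar>)"
      unfolding exp_add by simp
    also have "\<bar>t\<bar> + - (pi - pi / 2) * \<bar>t\<bar> = - (pi / 2 - 1) * \<bar>t\<bar>"
      by (simp add: algebra_simps)
    finally show ?thesis by (simp add: norm_mult w_def)
  qed
  have lim': "AE t in lborel. (\<lambda>n. A n t * k t) \<longlonglongrightarrow> A' t * k t"
    using lim by (auto intro!: tendsto_intros)
  have le': "AE t in lborel. norm (A n t * k t) \<le> w t" for n
    using le by simp
  have m1: "(\<lambda>t. A n t * k t) \<in> borel_measurable lborel" for n by measurable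
  have m2: "(\<lambda>t. A' t * k t) \<in> borel_measurable lborel" by measurable
  show "integrable lborel (\<lambda>t. A n t * k t)"
    by (rule integrable_dominated_convergence2[OF m2 m1 w lim' le'])
  show "integrable lborel (\<lambda>t. A' t * k t)"
    by (rule integrable_dominated_convergence[OF m2 m1 w lim' le'])
  show "(\<lambda>n. \<integral>t. A n t * k t \<partial>lborel) \<longlonglongrightarrow> (\<integral>t. A' t * k t \<partial>lborel)"
    by (rule integral_dominated_convergence[OF m2 m1 w lim' le'])
qed

lemma F0_integral_representation:
  assumes chi: "zero_mean_periodic d (\<lambda>n. chi (int (Suc n)))" and x: "Re x > 0"
  defines "Z \<equiv> \<lambda>t. L_function chi (1 / 2 + \<i> * complex_of_real t)"
  defines "k \<equiv> \<lambda>x t. exp (- \<i> * Ln x * complex_of_real t) / of_real (cosh (pi * t))"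
  shows "F0_converges chi x"
    and "integrable lborel (\<lambda>t. Z t * Z (- t) * k x t)"
    and "csqrt x * F0 chi x = - 1 / 2 * (\<integral>t. Z t * Z (- t) * k x t \<partial>lborel)"
proof -
  define a where "a n t = of_nat (Suc n) powr (- (1 / 2 + \<i> * complex_of_real t))" for n t
  define S where "S N t = (\<Sum>n<N. chi (int (Suc n)) * a n t)" for N t
  have S_lim: "(\<lambda>N. S N t) \<longlonglongrightarrow> Z t" for t
    using L_function_sums[OF chi, of "1 / 2 + \<i> * of_real t"] by (simp add: sums_def S_def a_def Z_def)
  obtain C where C: "C > 0" "\<And>N t. norm (S N t) \<le> C * (1 + \<bar>t\<bar>)"
    using critical_line_partial_sums_bound[OF chi] unfolding S_def a_def by metis
  have Z_le: "norm (Z t) \<le> C * (1 + \<bar>t\<bar>)" for t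
    by (rule LIMSEQ_le_const2[OF tendsto_norm[OF S_lim]]) (use C(2) in auto)
  have Z_cont: "continuous_on UNIV Z"
    unfolding Z_def
    by (rule continuous_on_compose2[OF holomorphic_on_imp_continuous_on[OF L_function_extends(1)[OF chi]]])
      (auto intro!: continuous_intros)
  have a_cont: "continuous_on UNIV (a n)" for n
    unfolding a_def by (intro continuous_intros) (auto simp del: of_nat_Suc)
  have S_cont: "continuous_on UNIV (S N)" for N
    unfolding S_def by (intro continuous_intros a_cont)
  have [measurable]: "Z \<in> borel_measurable borel" "S N \<in> borel_measurable borel" "a n \<in> borel_measurable borel" for N n
    using Z_cont S_cont a_cont by (auto intro: borel_measurable_continuous_onI)
  \<comment> \<open>The linear bound is weakened to a quadratic one so that the same convergence
    lemma serves the inner sum too.\<close>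
  have sq_le: "C * (1 + \<bar>t\<bar>) \<le> C * (1 + \<bar>t\<bar>)\<^sup>2" for t
    using C(1) by (intro mult_left_mono self_le_power) auto
  have S_le2: "norm (S N (- t)) \<le> C * (1 + \<bar>t\<bar>)\<^sup>2" for N t
    using C(2)[of N "- t"] sq_le[of t] by simp
  have neg_meas: "(\<lambda>t. S N (- t)) \<in> borel_measurable lborel" "(\<lambda>t. Z (- t)) \<in> borel_measurable lborel" for N
    by measurable
  have kernel: "exp (- \<i> * Ln y * complex_of_real t) / of_real (cosh (pi * t)) = k y t" for y t
    by (simp add: k_def)

  have inner: "(\<lambda>m. chi (int (Suc m)) / (of_nat (Suc m) + y)) sums
      (1 / 2 * (\<integral>t. Z (- t) * k y t \<partial>lborel) / exp (Ln y / 2))" if y: "Re y > 0" for y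
  proof -
    note conv = kernel_dominated_convergence[OF y neg_meas S_lim S_le2, unfolded kernel]
    \<comment> \<open>A single term is the difference of two consecutive partial sums, whose
      integrability is already known.\<close>
    have int_a: "integrable lborel (\<lambda>t. chi (int (Suc m)) * a m (- t) * k y t)" for m
      using Bochner_Integration.integrable_diff[OF conv(1)[of "Suc m"] conv(1)[of m]]
      by (simp add: S_def algebra_simps)
    have summand: "chi (int (Suc m)) / (of_nat (Suc m) + y) =
        1 / 2 * (\<integral>t. chi (int (Suc m)) * a m (- t) * k y t \<partial>lborel) / exp (Ln y / 2)" for m
    proof -
      have "exp (Ln y / 2) * (1 / (of_nat (Suc m) + y)) = 1 / 2 * (\<integral>t. a m (- t) * k y t \<partial>lborel)"
        using inverse_add_eq_integral[of "real (Suc m)" y] y by (simp add: a_def k_def)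
      then have "1 / (of_nat (Suc m) + y) = 1 / 2 * (\<integral>t. a m (- t) * k y t \<partial>lborel) / exp (Ln y / 2)"
        by (simp add: field_simps)
      then have "chi (int (Suc m)) * (1 / (of_nat (Suc m) + y)) =
          1 / 2 * (chi (int (Suc m)) * (\<integral>t. a m (- t) * k y t \<partial>lborel)) / exp (Ln y / 2)"
        by simp
      also have "chi (int (Suc m)) * (\<integral>t. a m (- t) * k y t \<partial>lborel) =
          (\<integral>t. chi (int (Suc m)) * a m (- t) * k y t \<partial>lborel)"
        by (simp only: integral_mult_right_zero mult.assoc)
      finally show ?thesis by simp
    qed
    have "(\<Sum>m<M. chi (int (Suc m)) / (of_nat (Suc m) + y)) =
        1 / 2 * (\<integral>t. S M (- t) * k y t \<partial>lborel) / exp (Ln y / 2)" for M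
    proof -
      have "(\<integral>t. S M (- t) * k y t \<partial>lborel) = (\<integral>t. (\<Sum>m<M. chi (int (Suc m)) * a m (- t) * k y t) \<partial>lborel)"
        by (simp add: S_def sum_distrib_right)
      also have "\<dots> = (\<Sum>m<M. \<integral>t. chi (int (Suc m)) * a m (- t) * k y t \<partial>lborel)"
        by (rule Bochner_Integration.integral_sum) (rule int_a)
      finally show ?thesis unfolding summand by (simp add: sum_distrib_left sum_divide_distrib)
    qed
    then show ?thesis
      unfolding sums_def by (simp only:) (intro tendsto_intros conv(3), simp)
  qed

  have nx: "Re (of_nat (Suc n) * x) > 0" for n
    using x by (simp add: add_pos_nonneg del: of_nat_Suc)
  have psi: "psi_chi chi (of_nat (Suc n) * x) = - 1 / 2 * (\<integral>t. a n t * (Z (- t) * k x t) \<partial>lborel) / exp (Ln x / 2)" for n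
  proof -
    let ?y = "of_nat (Suc n) * x"
    have x0: "x \<noteq> 0" using x by auto
    have Ln: "Ln ?y = of_real (ln (real (Suc n))) + Ln x"
      using Ln_times_of_real[of "real (Suc n)" x] x0 by (simp add: Ln_of_nat del: of_nat_Suc)
    \<comment> \<open>The logarithm splits because \<open>Suc n\<close> is a positive real, so the
      dilation of \<open>x\<close> separates from the kernel as the factor \<open>a n t\<close>, a
      term of the series for L(1/2 + it).\<close>
    have ka: "k ?y t / exp (Ln ?y / 2) = a n t * k x t / exp (Ln x / 2)" for t
    proof -
      have "exp (- \<i> * Ln ?y * complex_of_real t) / exp (Ln ?y / 2) = exp (- \<i> * Ln ?y * complex_of_real t - Ln ?y / 2)"
        by (simp add: exp_diff)
      also have "- \<i> * Ln ?y * complex_of_real t - Ln ?y / 2 =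
         - (1 / 2 + \<i> * complex_of_real t) * of_real (ln (real (Suc n))) + (- \<i> * Ln x * of_real t - Ln x / 2)"
        unfolding Ln by (simp add: algebra_simps add_divide_distrib)
      also have "exp \<dots> = a n t * (exp (- \<i> * Ln x * of_real t) / exp (Ln x / 2))"
      proof -
        have "a n t = exp (- (1 / 2 + \<i> * complex_of_real t) * of_real (ln (real (Suc n))))"
          unfolding a_def powr_def by (simp add: Ln_of_nat del: of_nat_Suc)
        then show ?thesis by (simp only: exp_add exp_diff)
      qed
      finally have quot: "exp (- \<i> * Ln ?y * complex_of_real t) / exp (Ln ?y / 2) =
          a n t * (exp (- \<i> * Ln x * of_real t) / exp (Ln x / 2))" .
      have "k ?y t / exp (Ln ?y / 2) =
          exp (- \<i> * Ln ?y * complex_of_real t) / exp (Ln ?y / 2) / of_real (cosh (pi * t))"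
        by (simp add: k_def)
      then show ?thesis unfolding quot by (simp add: k_def)
    qed
    have "psi_chi chi ?y = - (1 / 2 * (\<integral>t. Z (- t) * k ?y t \<partial>lborel) / exp (Ln ?y / 2))"
      using inner[OF nx] by (simp add: psi_chi_def sums_iff)
    also have "\<dots> = - (1 / 2 * (\<integral>t. Z (- t) * (k ?y t / exp (Ln ?y / 2)) \<partial>lborel))"
      by (simp add: mult.commute flip: Bochner_Integration.integral_divide_zero)
    also have "\<dots> = - (1 / 2 * ((\<integral>t. a n t * (Z (- t) * k x t) \<partial>lborel) / exp (Ln x / 2)))"
      unfolding ka Bochner_Integration.integral_divide_zero[symmetric] by (simp add: mult_ac)
    finally show ?thesis by simp
  qed

  have prod_le: "norm (S N t * Z (- t)) \<le> C\<^sup>2 * (1 + \<bar>t\<bar>)\<^sup>2" for N t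
  proof -
    have "norm (S N t) * norm (Z (- t)) \<le> (C * (1 + \<bar>t\<bar>)) * (C * (1 + \<bar>t\<bar>))"
      using C(2)[of N t] Z_le[of "- t"] C(1) by (intro mult_mono) auto
    then show ?thesis by (simp add: norm_mult power2_eq_square mult_ac)
  qed
  have prod_lim: "(\<lambda>N. S N t * Z (- t)) \<longlonglongrightarrow> Z t * Z (- t)" for t
    by (intro tendsto_intros S_lim)
  have prod_meas: "(\<lambda>t. S N t * Z (- t)) \<in> borel_measurable lborel" "(\<lambda>t. Z t * Z (- t)) \<in> borel_measurable lborel" for N
    by measurable
  note conv = kernel_dominated_convergence[OF x prod_meas prod_lim prod_le, unfolded kernel]
  show "integrable lborel (\<lambda>t. Z t * Z (- t) * k x t)" by (rule conv(2))
  have int_a: "integrable lborel (\<lambda>t. chi (int (Suc n)) * (a n t * (Z (- t) * k x t)))" for n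
    using Bochner_Integration.integrable_diff[OF conv(1)[of "Suc n"] conv(1)[of n]]
    by (simp add: S_def algebra_simps)
  \<comment> \<open>Second limit: the inner sum is already replaced by \<open>Z (- t)\<close>, and
    the partial sums over \<open>n\<close> are those of L(1/2 + it).\<close>
  have outer: "(\<lambda>n. chi (int (Suc n)) * psi_chi chi (of_nat (Suc n) * x)) sums
      (- 1 / 2 * (\<integral>t. Z t * Z (- t) * k x t \<partial>lborel) / exp (Ln x / 2))"
  proof -
    have "(\<Sum>n<N. chi (int (Suc n)) * psi_chi chi (of_nat (Suc n) * x)) =
        - 1 / 2 * (\<integral>t. S N t * Z (- t) * k x t \<partial>lborel) / exp (Ln x / 2)" for N
    proof -
      have "(\<integral>t. S N t * Z (- t) * k x t \<partial>lborel) =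
          (\<integral>t. (\<Sum>n<N. chi (int (Suc n)) * (a n t * (Z (- t) * k x t))) \<partial>lborel)"
        by (simp add: S_def sum_distrib_right mult.assoc)
      also have "\<dots> = (\<Sum>n<N. \<integral>t. chi (int (Suc n)) * (a n t * (Z (- t) * k x t)) \<partial>lborel)"
        by (rule Bochner_Integration.integral_sum) (rule int_a)
      also have "\<dots> = (\<Sum>n<N. chi (int (Suc n)) * (\<integral>t. a n t * (Z (- t) * k x t) \<partial>lborel))"
        by (simp only: integral_mult_right_zero)
      finally show ?thesis unfolding psi
        by (simp add: sum_distrib_left sum_divide_distrib mult_ac flip: sum_negf)
    qed
    then show ?thesis
      unfolding sums_def by (simp only:) (intro tendsto_intros conv(3), simp)
  qed
  show "F0_converges chi x"
    unfolding F0_converges_def using inner[OF nx] outer by (auto simp: sums_iff)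
  have "x \<noteq> 0" using x by auto
  then show "csqrt x * F0 chi x = - 1 / 2 * (\<integral>t. Z t * Z (- t) * k x t \<partial>lborel)"
    using outer by (simp add: F0_def sums_iff csqrt_exp_Ln)
qed

section \<open>From the hyperbolic secant kernel to the Xi-integral\<close>

lemma norm_Gamma_half_squared:
  "complex_of_real ((norm (Gamma (1 / 2 + \<i> * of_real t)))\<^sup>2) = of_real (pi / cosh (pi * t))"
proof -
  let ?z = "1 / 2 + \<i> * complex_of_real t"
  \<comment> \<open>On the line of real part 1/2, conjugation is z -> 1 - z, so the squared modulus
    is the product in the reflection formula.\<close>
  have "complex_of_real ((norm (Gamma ?z))\<^sup>2) = Gamma ?z * Gamma (1 - ?z)"
    by (simp only: complex_norm_square cnj_Gamma) simp
  also have "\<dots> = of_real pi / sin (of_real pi * ?z)" by (rule Gamma_reflection_complex)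
  also have "of_real pi * ?z = \<i> * of_real (pi * t) + of_real pi / 2" by (simp add: algebra_simps)
  also have "sin (\<i> * of_real (pi * t) + of_real pi / 2) = cos (\<i> * of_real (pi * t))"
    by (simp add: sin_add flip: cos_of_real sin_of_real)
  also have "cos (\<i> * of_real (pi * t)) = of_real (cosh (pi * t))"
    by (simp add: cos_exp_eq cosh_def flip: exp_of_real)
  finally show ?thesis by simp
qed

text \<open>The Gamma factors of the two Xi values are conjugate to each other, so their product
  cancels the squared modulus in the denominator. The imaginary parts of the exponents of pi/d
  cancel as well, and the Gamma quotient's numerator becomes the secant.\<close>

lemma Xi_integrand_eq:
  assumes d: "d > 0"
  shows "Xi_integrand d chi \<alpha> t =
    of_real (pi * (pi / real d) powr (- (real (char_b chi) + 1 / 2))) *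
    (L_function chi (1 / 2 + \<i> * of_real (t / 2)) * L_function chi (1 / 2 + \<i> * of_real (- (t / 2))) /
      of_real (cosh (pi * (t / 2))) * cos (Ln \<alpha> * of_real (t / 2)))"
proof -
  define b where "b = char_b chi"
  define g where "g = Gamma (1 / 4 + \<i> * of_real t / 4 + of_nat b / 2)"
  define c where "c = pi / real d"
  have c: "c > 0" using d by (simp add: c_def)
  \<comment> \<open>The argument has positive real part, so it is no pole; \<open>Gamma\<close>
    takes the value 0 exactly at its poles, hence \<open>g\<close> can be cancelled.\<close>
  have "1 / 4 + \<i> * of_real t / 4 + of_nat b / 2 \<notin> \<int>\<^sub>\<le>\<^sub>0"
  proof
    assume "1 / 4 + \<i> * of_real t / 4 + of_nat b / 2 \<in> \<int>\<^sub>\<le>\<^sub>0"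
    then obtain n where n: "1 / 4 + \<i> * of_real t / 4 + of_nat b / 2 = complex_of_int n" "n \<le> 0"
      by (rule nonpos_Ints_cases)
    from arg_cong[OF n(1), of Re] have "1 / 4 + real b / 2 = real_of_int n" by simp
    then show False using n(2) by linarith
  qed
  then have g: "g \<noteq> 0" by (simp add: g_def Gamma_eq_zero_iff)
  have gg: "complex_of_real ((norm g)\<^sup>2) = g * cnj g" by (simp only: complex_norm_square)
  have cg: "Gamma (1 / 4 - \<i> * of_real t / 4 + of_nat b / 2) = cnj g"
    by (simp add: g_def cnj_Gamma)
  have pw: "complex_of_real c powr (- (1 / 2 + \<i> * (- of_real t / 2) + of_nat b) / 2) *
      complex_of_real c powr (- (1 / 2 + \<i> * (of_real t / 2) + of_nat b) / 2) = of_real (c powr (- (real b + 1 / 2)))"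
  proof -
    have "complex_of_real (c powr (- (real b + 1 / 2))) = of_real c powr of_real (- (real b + 1 / 2))"
      using c by (intro powr_of_real[symmetric]) simp
    also have "complex_of_real (- (real b + 1 / 2)) =
       - (1 / 2 + \<i> * (- of_real t / 2) + of_nat b) / 2 + - (1 / 2 + \<i> * (of_real t / 2) + of_nat b) / 2"
      by (simp add: field_simps)
    finally show ?thesis unfolding powr_add by simp
  qed
  have X1: "Xi_chi d chi (- of_real t / 2) = of_real c powr (- (1 / 2 + \<i> * (- of_real t / 2) + of_nat b) / 2) *
      cnj g * L_function chi (1 / 2 + \<i> * of_real (- (t / 2)))"
  proof -
    have arg: "(1 / 2 + \<i> * (- of_real t / 2) + of_nat b) / 2 = 1 / 4 - \<i> * of_real t / 4 + of_nat b / 2"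
      by (simp add: field_simps)
    show ?thesis
      unfolding Xi_chi_def xi_chi_def b_def[symmetric] c_def[symmetric] cg[symmetric] arg by simp
  qed
  have X2: "Xi_chi d chi (of_real t / 2) = of_real c powr (- (1 / 2 + \<i> * (of_real t / 2) + of_nat b) / 2) *
      g * L_function chi (1 / 2 + \<i> * of_real (t / 2))"
  proof -
    have arg: "(1 / 2 + \<i> * (of_real t / 2) + of_nat b) / 2 = 1 / 4 + \<i> * of_real t / 4 + of_nat b / 2"
      by (simp add: field_simps)
    show ?thesis
      unfolding Xi_chi_def xi_chi_def b_def[symmetric] c_def[symmetric] arg g_def by simp
  qed
  have G: "complex_of_real ((norm (Gamma (1 / 2 + \<i> * of_real t / 2) / g))\<^sup>2) =
      of_real (pi / cosh (pi * (t / 2))) / (g * cnj g)"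
    using norm_Gamma_half_squared[of "t / 2"] by (simp add: norm_divide power_divide gg[symmetric])
  have "Xi_integrand d chi \<alpha> t = of_real (pi / cosh (pi * (t / 2))) / (g * cnj g) *
     (of_real c powr (- (1 / 2 + \<i> * (- of_real t / 2) + of_nat b) / 2) *
      cnj g * L_function chi (1 / 2 + \<i> * of_real (- (t / 2)))) *
     (of_real c powr (- (1 / 2 + \<i> * (of_real t / 2) + of_nat b) / 2) *
      g * L_function chi (1 / 2 + \<i> * of_real (t / 2))) * cos (of_real t / 2 * Ln \<alpha>)"
    unfolding Xi_integrand_def b_def[symmetric] g_def[symmetric] X1 X2 G ..
  also have "\<dots> = of_real (pi / cosh (pi * (t / 2))) *
     (of_real c powr (- (1 / 2 + \<i> * (- of_real t / 2) + of_nat b) / 2) *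
      of_real c powr (- (1 / 2 + \<i> * (of_real t / 2) + of_nat b) / 2)) *
     (L_function chi (1 / 2 + \<i> * of_real (t / 2)) * L_function chi (1 / 2 + \<i> * of_real (- (t / 2)))) *
     cos (of_real t / 2 * Ln \<alpha>)"
    using g by (simp add: mult_ac)
  finally show ?thesis unfolding pw by (simp add: b_def c_def mult_ac)
qed

text \<open>Averaging the integrand over t and -t turns the exponential into a cosine. Rescaling t
  to t/2 doubles the integral, and restricting the even integrand to the half-line halves it, so no
  constant remains.\<close>

lemma fold_fourier_integral:
  fixes W :: "real \<Rightarrow> complex" and u :: complex
  assumes even: "\<And>t. W (- t) = W t"
    and int: "integrable lborel (\<lambda>t. W t * exp (- \<i> * u * of_real t))"
  shows "set_integrable lborel {0..} (\<lambda>t. W (t / 2) * cos (u * of_real (t / 2)))"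
    and "(\<integral>t. W t * exp (- \<i> * u * of_real t) \<partial>lborel) = (LBINT t:{0..}. W (t / 2) * cos (u * of_real (t / 2)))"
proof -
  let ?h = "\<lambda>t. W t * exp (- \<i> * u * of_real t)"
  let ?e = "\<lambda>t. W t * cos (u * of_real t)"
  have int': "integrable lborel (\<lambda>t. ?h (- t))"
    using lborel_integrable_real_affine[OF int, of "-1" 0] by simp
  have refl: "integral\<^sup>L lborel (\<lambda>t. ?h (- t)) = integral\<^sup>L lborel ?h"
    using lborel_integral_real_affine[of "-1" ?h 0] by simp
  have e_eq: "?e t = (?h t + ?h (- t)) / 2" for t
    by (simp add: even cos_exp_eq field_simps)
  have e_int: "integrable lborel ?e"
    unfolding e_eq using int int' by simp
  have e_val: "integral\<^sup>L lborel ?e = integral\<^sup>L lborel ?h"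
  proof -
    have "integral\<^sup>L lborel ?e = (integral\<^sup>L lborel ?h + integral\<^sup>L lborel (\<lambda>t. ?h (- t))) / 2"
      unfolding e_eq integral_divide_zero by (subst Bochner_Integration.integral_add[OF int int']) simp
    then show ?thesis unfolding refl by simp
  qed
  let ?s = "\<lambda>t. ?e (t / 2)"
  have s_int: "integrable lborel ?s"
    using lborel_integrable_real_affine[OF e_int, of "1 / 2" 0] by simp
  have s_val: "integral\<^sup>L lborel ?s = 2 * integral\<^sup>L lborel ?e"
  proof -
    have "integral\<^sup>L lborel ?e = 1 / 2 * integral\<^sup>L lborel ?s"
      using lborel_integral_real_affine[of "1 / 2" ?e 0] by (simp add: scaleR_conv_of_real)
    then show ?thesis by (simp only:) simp
  qed
  show s_set: "set_integrable lborel {0..} ?s"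
    unfolding set_integrable_def using s_int by (rule integrable_mult_indicator[rotated]) simp
  have "has_bochner_integral lborel ?s (2 *\<^sub>R (LBINT t:{0..}. ?s t))"
  proof (rule has_bochner_integral_even_function)
    show "has_bochner_integral lborel (\<lambda>t. indicator {0..} t *\<^sub>R ?s t) (LBINT t:{0..}. ?s t)"
      using s_set unfolding set_integrable_def set_lebesgue_integral_def
      by (rule has_bochner_integral_integrable)
    show "?s (- t) = ?s t" for t using even[of "t / 2"] by simp
  qed
  then have "integral\<^sup>L lborel ?s = 2 *\<^sub>R (LBINT t:{0..}. ?s t)"
    by (rule has_bochner_integral_integral_eq)
  then have "2 * integral\<^sup>L lborel ?h = 2 * (LBINT t:{0..}. ?s t)"
    unfolding s_val e_val by (simp add: scaleR_conv_of_real)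
  then show "integral\<^sup>L lborel ?h = (LBINT t:{0..}. ?s t)"
    by simp
qed

lemma F0_eq_Xi_integral:
  assumes chi: "zero_mean_periodic d (\<lambda>n. chi (int (Suc n)))" and x: "Re x > 0"
  shows "F0_converges chi x" "set_integrable lborel {0..} (Xi_integrand d chi x)"
    and "csqrt x * F0 chi x =
      - complex_of_real (1 / (2 * pi) * (pi / real d) powr (real (char_b chi) + 1 / 2)) *
      (LBINT t:{0..}. Xi_integrand d chi x t)"
proof -
  have d: "d > 0" using chi by (simp add: zero_mean_periodic_def)
  define Z where "Z t = L_function chi (1 / 2 + \<i> * complex_of_real t)" for t
  define W where "W t = Z t * Z (- t) / of_real (cosh (pi * t))" for t
  define p where "p = (pi / real d) powr (real (char_b chi) + 1 / 2)"
  have p: "p > 0" using d by (simp add: p_def)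
  note rep = F0_integral_representation[OF chi x, folded Z_def]
  have WZ: "Z t * Z (- t) * (exp (- \<i> * Ln x * of_real t) / of_real (cosh (pi * t))) =
      W t * exp (- \<i> * Ln x * of_real t)" for t
    by (simp add: W_def)
  have "W (- t) = W t" for t by (simp add: W_def mult.commute)
  note fold = fold_fourier_integral[OF this rep(2)[unfolded WZ]]
  \<comment> \<open>The integrand carries the constant pi/p; its inverse p/pi, times the -1/2 of the
    integral representation, is the prefactor -p/(2 pi).\<close>
  have Xi: "Xi_integrand d chi x = (\<lambda>t. of_real (pi / p) * (W (t / 2) * cos (Ln x * of_real (t / 2))))"
  proof
    fix t
    have "pi * (pi / real d) powr (- (real (char_b chi) + 1 / 2)) = pi / p"
      by (simp only: p_def powr_minus divide_inverse)
    then show "Xi_integrand d chi x t = of_real (pi / p) * (W (t / 2) * cos (Ln x * of_real (t / 2)))"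
      unfolding Xi_integrand_eq[OF d] by (simp only: W_def Z_def)
  qed
  show "F0_converges chi x" by (rule rep(1))
  show "set_integrable lborel {0..} (Xi_integrand d chi x)"
    unfolding Xi by (rule set_integrable_mult_right) (rule fold(1))
  have "csqrt x * F0 chi x = - 1 / 2 * (LBINT t:{0..}. W (t / 2) * cos (Ln x * of_real (t / 2)))"
    unfolding rep(3) WZ fold(2) ..
  also have "(LBINT t:{0..}. W (t / 2) * cos (Ln x * of_real (t / 2))) =
      of_real (p / pi) * (LBINT t:{0..}. Xi_integrand d chi x t)"
    unfolding Xi set_integral_mult_right using p by simp
  also have "- 1 / 2 * (of_real (p / pi) * (LBINT t:{0..}. Xi_integrand d chi x t)) =
      - complex_of_real (1 / (2 * pi) * p) * (LBINT t:{0..}. Xi_integrand d chi x t)"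
    by simp
  finally show "csqrt x * F0 chi x =
      - complex_of_real (1 / (2 * pi) * (pi / real d) powr (real (char_b chi) + 1 / 2)) *
      (LBINT t:{0..}. Xi_integrand d chi x t)"
    by (simp only: p_def)
qed

theorem theorem2p8:
  fixes d :: nat and chi :: "int \<Rightarrow> complex" and \<alpha> \<beta> :: complex
  assumes "primitive_character d chi"
    and "chi \<noteq> principal_character d"
    and "Re \<alpha> > 0" and "Re \<beta> > 0" and "\<alpha> * \<beta> = 1"
  shows "F0_converges chi \<alpha> \<and> F0_converges chi \<beta> \<and>
    set_integrable lborel {0..} (Xi_integrand d chi \<alpha>) \<and>
    csqrt \<alpha> * F0 chi \<alpha> = csqrt \<beta> * F0 chi \<beta> \<and>
    csqrt \<beta> * F0 chi \<beta> =
      - complex_of_real (1 / (2 * pi) * (pi / real d) powr (real (char_b chi) + 1 / 2)) *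
      (LBINT t:{0..}. Xi_integrand d chi \<alpha> t)"
proof -
  have chi: "zero_mean_periodic d (\<lambda>n. chi (int (Suc n)))"
    using assms by (intro nonprincipal_zero_mean) (auto simp: primitive_character_def)
  have "\<beta> = inverse \<alpha>" using assms(5) by (metis inverse_unique)
  moreover have "\<alpha> \<notin> \<real>\<^sub>\<le>\<^sub>0" using assms(3) by (auto simp: complex_nonpos_Reals_iff)
  \<comment> \<open>The right half-plane avoids the branch cut, so inversion negates the logarithm;
    the cosine is even, so both points share one integrand and hence one value.\<close>
  ultimately have Ln: "Ln \<beta> = - Ln \<alpha>" by (simp add: Ln_inverse)
  have "Xi_integrand d chi \<beta> = Xi_integrand d chi \<alpha>"
    by (rule ext) (simp add: Xi_integrand_def Ln)
  then show ?thesis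
    using F0_eq_Xi_integral[OF chi assms(3)] F0_eq_Xi_integral[OF chi assms(4)] by simp
qed

end
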